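(* Let $u$ be the optimal control of the optimal control problem described in the context. For any $\zeta\in V$, let $v_\zeta\in U_{\mathrm{ad}}$ be given by $v_\zeta(\boldsymbol{x})=\min\{u_b(\boldsymbol{x}),\max\{u_a(\boldsymbol{x}),u_d(\boldsymbol{x})-\tfrac1\lambda\zeta(\boldsymbol{x})\}\}$ for a.e. $\boldsymbol{x}\in\Omega$. Then for arbitrary $\eta\in V$, $\boldsymbol{\tau},\boldsymbol{\rho}\in H(\mathrm{div},\Omega)$ and $\alpha,\beta>0$, $$|||u-v_\zeta|||^2\le\mathcal{M}^\oplus(\alpha,\beta;\eta,\zeta,\boldsymbol{\tau},\boldsymbol{\rho},v_\zeta):=\mathcal{J}^\oplus(\alpha,\beta;\eta,\boldsymbol{\tau},v_\zeta)-\mathcal{J}^\ominus(\eta,\zeta,\boldsymbol{\tau},\boldsymbol{\rho},v_\zeta),$$ where $$\mathcal{M}^\oplus(\alpha,\beta;\eta,\zeta,\boldsymbol{\tau},\boldsymbol{\rho},v_\zeta)=\tfrac\alpha2\|\eta-y_d\|^2+\tfrac{(1+\alpha)(1+\beta)C_F^2}{2\alpha\underline\nu^2}\|\boldsymbol{\tau}-\nu\nabla\eta\|^2+\tfrac{(1+\alpha)(1+\beta)C_F^4}{2\alpha\beta\underline\nu^2}\|f+v_\zeta+\mathrm{div}\,\boldsymbol{\tau}\|^2$$ $$-\int_\Omega(f+v_\zeta+\mathrm{div}\,\boldsymbol{\tau})\zeta\,d\boldsymbol{x}-\int_\Omega(\boldsymbol{\tau}-\nu\nabla\eta)\cdot\nabla\zeta\,d\boldsymbol{x}$$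 $$+\tfrac1{\underline\nu}\big(C_F\|\eta-y_d+\mathrm{div}\,\boldsymbol{\rho}\|+\|\boldsymbol{\rho}-\nu\nabla\zeta\|\big)\Big(\tfrac{C_F^3}{\lambda\underline\nu}\|\eta-y_d+\mathrm{div}\,\boldsymbol{\rho}\|+\tfrac{C_F^2}{\lambda\underline\nu}\|\boldsymbol{\rho}-\nu\nabla\zeta\|+C_F\|f+v_\zeta+\mathrm{div}\,\boldsymbol{\tau}\|+\|\boldsymbol{\tau}-\nu\nabla\eta\|\Big).$$
   Context: Let $\Omega\subset\mathbb{R}^d$, $d\in\{1,2,3\}$, be a bounded Lipschitz domain, $V=H^1_0(\Omega)$, $y_d,u_d,f\in L^2(\Omega)$, $\lambda>0$. Let $\nu:\Omega\to\mathbb{R}$ be measurable with $0<\underline{\nu}\le\nu(\boldsymbol{x})\le\overline{\nu}$ for constants $\underline\nu,\overline\nu$. All functions are real valued; $\|\cdot\|$ is the $L^2(\Omega)$-norm (also for vector fields). $H(\mathrm{div},\Omega)=\{\boldsymbol{\tau}\in[L^2(\Omega)]^d:\mathrm{div}\,\boldsymbol{\tau}\in L^2(\Omega)\}$. $C_F>0$ is a Friedrichs constant: $\|w\|\le C_F\|\nabla w\|$ for all $w\in V$. For $v\in L^2(\Omega)$, $y(v)\in V$ is the weak solution of $\int_\Omega\nu\nabla y(v)\cdot\nabla w\,d\boldsymbol{x}=\int_\Omega(f+v)w\,d\boldsymbol{x}$ for all $w\in V$. The cost functional is $\mathcal{J}(y(v),v)=\frac12\|y(v)-y_d\|^2+\frac\lambda2\|v-u_d\|^2$.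 Admissible controls: $U_{\mathrm{ad}}=\{v\in L^2(\Omega):u_a\le v\le u_b\text{ a.e. in }\Omega\}$, where $u_a,u_b\in L^2(\Omega)$, $u_a\le u_b$ a.e. The optimal control $u$ is the unique minimizer of $v\mapsto\mathcal{J}(y(v),v)$ over $U_{\mathrm{ad}}$. Error measure: $|||u-v|||^2:=\frac12\|y(u)-y(v)\|^2+\frac\lambda2\|u-v\|^2$. Majorant of the cost functional: $$\mathcal{J}^\oplus(\alpha,\beta;\eta,\boldsymbol{\tau},v)=\tfrac{1+\alpha}2\|\eta-y_d\|^2+\tfrac{(1+\alpha)(1+\beta)C_F^2}{2\alpha\underline\nu^2}\|\boldsymbol{\tau}-\nu\nabla\eta\|^2+\tfrac{(1+\alpha)(1+\beta)C_F^4}{2\alpha\beta\underline\nu^2}\|f+v+\mathrm{div}\,\boldsymbol{\tau}\|^2+\tfrac\lambda2\|v-u_d\|^2.$$ Minorant of the cost functional: $$\mathcal{J}^\ominus(\eta,\zeta,\boldsymbol{\tau},\boldsymbol{\rho},v_\zeta)=\tfrac12\|\eta-y_d\|^2+\tfrac\lambda2\|v_\zeta-u_d\|^2+\int_\Omega(f+v_\zeta+\mathrm{div}\,\boldsymbol{\tau})\zeta\,d\boldsymbol{x}+\int_\Omega(\boldsymbol{\tau}-\nu\nabla\eta)\cdot\nabla\zeta\,d\boldsymbol{x}$$ $$-\tfrac1{\underline\nu}\big(C_F\|\eta-y_d+\mathrm{div}\,\boldsymbol{\rho}\|+\|\boldsymbol{\rho}-\nu\nabla\zeta\|\big)\Big(\tfrac{C_F^3}{\lambda\underline\nu}\|\eta-y_d+\mathrm{div}\,\boldsymbol{\rho}\|+\tfrac{C_F^2}{\lambda\underline\nu}\|\boldsymbol{\rho}-\nu\nabla\zeta\|+C_F\|f+v_\zeta+\mathrm{div}\,\boldsymbol{\tau}\|+\|\boldsymbol{\tau}-\nu\nabla\eta\|\Big).$$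 *)

theory Defs
  imports "HOL-Analysis.Analysis"
begin

text \<open>
  A bounded domain is Lipschitz if near each boundary point it is the strict epigraph, in
  direction \<open>n\<close>, of a Lipschitz function of the coordinates orthogonal to \<open>n\<close>.  The graph
  function \<open>g\<close> is only ever evaluated on the hyperplane orthogonal to \<open>n\<close>; demanding that it is
  Lipschitz on the whole space is no restriction, as one can compose with the orthogonal projection.
\<close>

definition bounded_lipschitz_domain :: "'a::euclidean_space set \<Rightarrow> bool" where
  "bounded_lipschitz_domain \<Omega> \<longleftrightarrow>
     open \<Omega> \<and> connected \<Omega> \<and> \<Omega> \<noteq> {} \<and> bounded \<Omega> \<and>
     (\<forall>x\<in>frontier \<Omega>. \<exists>n (g :: 'a \<Rightarrow> real) C r. norm n = 1 \<and> r > 0 \<and> C-lipschitz_on UNIV g \<and>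
        \<Omega> \<inter> ball x r = {z \<in> ball x r. z \<bullet> n > g (z - (z \<bullet> n) *\<^sub>R n)})"

text \<open>
  Elements of the Lebesgue and Sobolev spaces are represented by functions on the whole type, of
  which only the values on \<open>\<Omega>\<close>, up to null sets, matter.
\<close>

definition L2 :: "'a::euclidean_space set \<Rightarrow> ('a \<Rightarrow> 'b::euclidean_space) set" where
  "L2 \<Omega> = {g \<in> borel_measurable (lebesgue_on \<Omega>). integrable (lebesgue_on \<Omega>) (\<lambda>x. (norm (g x))\<^sup>2)}"

definition L2norm :: "'a::euclidean_space set \<Rightarrow> ('a \<Rightarrow> 'b::euclidean_space) \<Rightarrow> real" where
  "L2norm \<Omega> g = sqrt (LINT x|lebesgue_on \<Omega>. (norm (g x))\<^sup>2)"

definition gradient :: "('a::euclidean_space \<Rightarrow> real) \<Rightarrow> 'a \<Rightarrow> 'a" where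
  "gradient \<phi> x = (\<Sum>i\<in>Basis. frechet_derivative \<phi> (at x) i *\<^sub>R i)"

primrec times_continuously_differentiable :: "nat \<Rightarrow> ('a::euclidean_space \<Rightarrow> real) \<Rightarrow> bool" where
  "times_continuously_differentiable 0 \<phi> \<longleftrightarrow> continuous_on UNIV \<phi>"
| "times_continuously_differentiable (Suc k) \<phi> \<longleftrightarrow>
     (\<forall>x. \<phi> differentiable (at x)) \<and>
     (\<forall>i\<in>Basis. times_continuously_differentiable k (\<lambda>x. gradient \<phi> x \<bullet> i))"

definition test_functions :: "'a::euclidean_space set \<Rightarrow> ('a \<Rightarrow> real) set" where
  "test_functions \<Omega> = {\<phi>. (\<forall>k. times_continuously_differentiable k \<phi>) \<and>
     compact (closure {x. \<phi> x \<noteq> 0}) \<and> closure {x. \<phi> x \<noteq> 0} \<subseteq> \<Omega>}"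

definition has_weak_gradient ::
    "'a::euclidean_space set \<Rightarrow> ('a \<Rightarrow> real) \<Rightarrow> ('a \<Rightarrow> 'a) \<Rightarrow> bool" where
  "has_weak_gradient \<Omega> w G \<longleftrightarrow> G \<in> L2 \<Omega> \<and>
     (\<forall>\<phi>\<in>test_functions \<Omega>.
        (LINT x|lebesgue_on \<Omega>. w x *\<^sub>R gradient \<phi> x) = - (LINT x|lebesgue_on \<Omega>. \<phi> x *\<^sub>R G x))"

text \<open>
  The weak gradient and the weak divergence are unique only up to null sets; the operators pick
  a representative.
\<close>

definition weak_gradient :: "'a::euclidean_space set \<Rightarrow> ('a \<Rightarrow> real) \<Rightarrow> 'a \<Rightarrow> 'a" where
  "weak_gradient \<Omega> w = (SOME G. has_weak_gradient \<Omega> w G)"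

definition H1 :: "'a::euclidean_space set \<Rightarrow> ('a \<Rightarrow> real) set" where
  "H1 \<Omega> = {w \<in> L2 \<Omega>. \<exists>G. has_weak_gradient \<Omega> w G}"

definition H10 :: "'a::euclidean_space set \<Rightarrow> ('a \<Rightarrow> real) set" where
  "H10 \<Omega> = {w \<in> H1 \<Omega>. \<forall>\<epsilon>>0. \<exists>\<phi>\<in>test_functions \<Omega>.
     sqrt ((L2norm \<Omega> (\<lambda>x. w x - \<phi> x))\<^sup>2 +
           (L2norm \<Omega> (\<lambda>x. weak_gradient \<Omega> w x - gradient \<phi> x))\<^sup>2) < \<epsilon>}"

definition has_weak_divergence ::
    "'a::euclidean_space set \<Rightarrow> ('a \<Rightarrow> 'a) \<Rightarrow> ('a \<Rightarrow> real) \<Rightarrow> bool" where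
  "has_weak_divergence \<Omega> \<tau> h \<longleftrightarrow> h \<in> L2 \<Omega> \<and>
     (\<forall>\<phi>\<in>test_functions \<Omega>.
        (LINT x|lebesgue_on \<Omega>. \<tau> x \<bullet> gradient \<phi> x) = - (LINT x|lebesgue_on \<Omega>. h x * \<phi> x))"

definition weak_divergence :: "'a::euclidean_space set \<Rightarrow> ('a \<Rightarrow> 'a) \<Rightarrow> 'a \<Rightarrow> real" where
  "weak_divergence \<Omega> \<tau> = (SOME h. has_weak_divergence \<Omega> \<tau> h)"

definition Hdiv :: "'a::euclidean_space set \<Rightarrow> ('a \<Rightarrow> 'a) set" where
  "Hdiv \<Omega> = {\<tau> \<in> L2 \<Omega>. \<exists>h. has_weak_divergence \<Omega> \<tau> h}"

definition friedrichs_constant :: "'a::euclidean_space set \<Rightarrow> real \<Rightarrow> bool" where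
  "friedrichs_constant \<Omega> C \<longleftrightarrow> C > 0 \<and>
     (\<forall>w\<in>H10 \<Omega>. L2norm \<Omega> w \<le> C * L2norm \<Omega> (weak_gradient \<Omega> w))"

definition weak_solution ::
    "'a::euclidean_space set \<Rightarrow> ('a \<Rightarrow> real) \<Rightarrow> ('a \<Rightarrow> real) \<Rightarrow> ('a \<Rightarrow> real) \<Rightarrow> bool" where
  "weak_solution \<Omega> \<nu> F y \<longleftrightarrow> y \<in> H10 \<Omega> \<and>
     (\<forall>w\<in>H10 \<Omega>.
        (LINT x|lebesgue_on \<Omega>. \<nu> x * (weak_gradient \<Omega> y x \<bullet> weak_gradient \<Omega> w x)) =
        (LINT x|lebesgue_on \<Omega>. F x * w x))"

text \<open>
  \<open>S\<close> is the control-to-state map, written \<open>v \<mapsto> y(v)\<close> on paper.  The values \<open>S v\<close> are determined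
  up to null sets.
\<close>

definition solution_operator ::
    "'a::euclidean_space set \<Rightarrow> ('a \<Rightarrow> real) \<Rightarrow> ('a \<Rightarrow> real) \<Rightarrow> (('a \<Rightarrow> real) \<Rightarrow> 'a \<Rightarrow> real) \<Rightarrow> bool" where
  "solution_operator \<Omega> \<nu> f S \<longleftrightarrow> (\<forall>v\<in>L2 \<Omega>. weak_solution \<Omega> \<nu> (\<lambda>x. f x + v x) (S v))"

definition cost ::
    "'a::euclidean_space set \<Rightarrow> real \<Rightarrow> ('a \<Rightarrow> real) \<Rightarrow> ('a \<Rightarrow> real) \<Rightarrow> ('a \<Rightarrow> real) \<Rightarrow> ('a \<Rightarrow> real) \<Rightarrow> real" where
  "cost \<Omega> lam y\<^sub>d u\<^sub>d y v =
     1/2 * (L2norm \<Omega> (\<lambda>x. y x - y\<^sub>d x))\<^sup>2 + lam/2 * (L2norm \<Omega> (\<lambda>x. v x - u\<^sub>d x))\<^sup>2"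

definition admissible_controls ::
    "'a::euclidean_space set \<Rightarrow> ('a \<Rightarrow> real) \<Rightarrow> ('a \<Rightarrow> real) \<Rightarrow> ('a \<Rightarrow> real) set" where
  "admissible_controls \<Omega> u\<^sub>a u\<^sub>b =
     {v \<in> L2 \<Omega>. AE x in lebesgue_on \<Omega>. u\<^sub>a x \<le> v x \<and> v x \<le> u\<^sub>b x}"

text \<open>Uniqueness of the minimizer is meant up to null sets and follows from strict convexity.\<close>

definition optimal_control ::
    "'a::euclidean_space set \<Rightarrow> real \<Rightarrow> ('a \<Rightarrow> real) \<Rightarrow> ('a \<Rightarrow> real) \<Rightarrow> ('a \<Rightarrow> real) \<Rightarrow> ('a \<Rightarrow> real) \<Rightarrow>
     (('a \<Rightarrow> real) \<Rightarrow> 'a \<Rightarrow> real) \<Rightarrow> ('a \<Rightarrow> real) \<Rightarrow> bool" where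
  "optimal_control \<Omega> lam y\<^sub>d u\<^sub>d u\<^sub>a u\<^sub>b S u \<longleftrightarrow>
     is_arg_min (\<lambda>v. cost \<Omega> lam y\<^sub>d u\<^sub>d (S v) v) (\<lambda>v. v \<in> admissible_controls \<Omega> u\<^sub>a u\<^sub>b) u"

definition error_sq ::
    "'a::euclidean_space set \<Rightarrow> real \<Rightarrow> (('a \<Rightarrow> real) \<Rightarrow> 'a \<Rightarrow> real) \<Rightarrow> ('a \<Rightarrow> real) \<Rightarrow> ('a \<Rightarrow> real) \<Rightarrow> real" where
  "error_sq \<Omega> lam S u v =
     1/2 * (L2norm \<Omega> (\<lambda>x. S u x - S v x))\<^sup>2 + lam/2 * (L2norm \<Omega> (\<lambda>x. u x - v x))\<^sup>2"

definition cost_majorant ::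
    "'a::euclidean_space set \<Rightarrow> ('a \<Rightarrow> real) \<Rightarrow> real \<Rightarrow> real \<Rightarrow> real \<Rightarrow> ('a \<Rightarrow> real) \<Rightarrow> ('a \<Rightarrow> real) \<Rightarrow> ('a \<Rightarrow> real) \<Rightarrow>
     real \<Rightarrow> real \<Rightarrow> ('a \<Rightarrow> real) \<Rightarrow> ('a \<Rightarrow> 'a) \<Rightarrow> ('a \<Rightarrow> real) \<Rightarrow> real" where
  "cost_majorant \<Omega> \<nu> \<nu>\<^sub>m C\<^sub>F lam f y\<^sub>d u\<^sub>d \<alpha> \<beta> \<eta> \<tau> v =
     (1 + \<alpha>) / 2 * (L2norm \<Omega> (\<lambda>x. \<eta> x - y\<^sub>d x))\<^sup>2
     + (1 + \<alpha>) * (1 + \<beta>) * C\<^sub>F^2 / (2 * \<alpha> * \<nu>\<^sub>m^2)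
         * (L2norm \<Omega> (\<lambda>x. \<tau> x - \<nu> x *\<^sub>R weak_gradient \<Omega> \<eta> x))\<^sup>2
     + (1 + \<alpha>) * (1 + \<beta>) * C\<^sub>F^4 / (2 * \<alpha> * \<beta> * \<nu>\<^sub>m^2)
         * (L2norm \<Omega> (\<lambda>x. f x + v x + weak_divergence \<Omega> \<tau> x))\<^sup>2
     + lam / 2 * (L2norm \<Omega> (\<lambda>x. v x - u\<^sub>d x))\<^sup>2"

definition cost_minorant ::
    "'a::euclidean_space set \<Rightarrow> ('a \<Rightarrow> real) \<Rightarrow> real \<Rightarrow> real \<Rightarrow> real \<Rightarrow> ('a \<Rightarrow> real) \<Rightarrow> ('a \<Rightarrow> real) \<Rightarrow> ('a \<Rightarrow> real) \<Rightarrow>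
     ('a \<Rightarrow> real) \<Rightarrow> ('a \<Rightarrow> real) \<Rightarrow> ('a \<Rightarrow> 'a) \<Rightarrow> ('a \<Rightarrow> 'a) \<Rightarrow> ('a \<Rightarrow> real) \<Rightarrow> real" where
  "cost_minorant \<Omega> \<nu> \<nu>\<^sub>m C\<^sub>F lam f y\<^sub>d u\<^sub>d \<eta> \<zeta> \<tau> \<rho> v =
     1/2 * (L2norm \<Omega> (\<lambda>x. \<eta> x - y\<^sub>d x))\<^sup>2
     + lam / 2 * (L2norm \<Omega> (\<lambda>x. v x - u\<^sub>d x))\<^sup>2
     + (LINT x|lebesgue_on \<Omega>. (f x + v x + weak_divergence \<Omega> \<tau> x) * \<zeta> x)
     + (LINT x|lebesgue_on \<Omega>. (\<tau> x - \<nu> x *\<^sub>R weak_gradient \<Omega> \<eta> x) \<bullet> weak_gradient \<Omega> \<zeta> x)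
     - 1 / \<nu>\<^sub>m
       * (C\<^sub>F * L2norm \<Omega> (\<lambda>x. \<eta> x - y\<^sub>d x + weak_divergence \<Omega> \<rho> x)
          + L2norm \<Omega> (\<lambda>x. \<rho> x - \<nu> x *\<^sub>R weak_gradient \<Omega> \<zeta> x))
       * (C\<^sub>F^3 / (lam * \<nu>\<^sub>m) * L2norm \<Omega> (\<lambda>x. \<eta> x - y\<^sub>d x + weak_divergence \<Omega> \<rho> x)
          + C\<^sub>F^2 / (lam * \<nu>\<^sub>m) * L2norm \<Omega> (\<lambda>x. \<rho> x - \<nu> x *\<^sub>R weak_gradient \<Omega> \<zeta> x)
          + C\<^sub>F * L2norm \<Omega> (\<lambda>x. f x + v x + weak_divergence \<Omega> \<tau> x)
          + L2norm \<Omega> (\<lambda>x. \<tau> x - \<nu> x *\<^sub>R weak_gradient \<Omega> \<eta> x))"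

definition error_majorant ::
    "'a::euclidean_space set \<Rightarrow> ('a \<Rightarrow> real) \<Rightarrow> real \<Rightarrow> real \<Rightarrow> real \<Rightarrow> ('a \<Rightarrow> real) \<Rightarrow> ('a \<Rightarrow> real) \<Rightarrow> ('a \<Rightarrow> real) \<Rightarrow>
     real \<Rightarrow> real \<Rightarrow> ('a \<Rightarrow> real) \<Rightarrow> ('a \<Rightarrow> real) \<Rightarrow> ('a \<Rightarrow> 'a) \<Rightarrow> ('a \<Rightarrow> 'a) \<Rightarrow> ('a \<Rightarrow> real) \<Rightarrow> real" where
  "error_majorant \<Omega> \<nu> \<nu>\<^sub>m C\<^sub>F lam f y\<^sub>d u\<^sub>d \<alpha> \<beta> \<eta> \<zeta> \<tau> \<rho> v =
     cost_majorant \<Omega> \<nu> \<nu>\<^sub>m C\<^sub>F lam f y\<^sub>d u\<^sub>d \<alpha> \<beta> \<eta> \<tau> v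
     - cost_minorant \<Omega> \<nu> \<nu>\<^sub>m C\<^sub>F lam f y\<^sub>d u\<^sub>d \<eta> \<zeta> \<tau> \<rho> v"

end

(*
  The estimate rests on J(v) - J(u) >= |||u - v|||^2, valid for admissible v
  because the cost is quadratic along the segment from u to v and u minimises it.  It then suffices
  to bound J(v_zeta) from above and J(u) from below.  The upper bound is the energy estimate for
  the state equation and Young's inequality.

  For the lower bound no adjoint state is needed.  Subtracting the state equation tested with zeta
  from J(u), and using that v_zeta satisfies the variational inequality of the projection, leaves
    lam/2 |u - v_zeta|^2 + R(y(u) - eta),
  where R is the residual of the adjoint equation at zeta.  Its norm K is controlled by rho.
  Splitting the argument at y(v_zeta), the unknown part R(y(u) - y(v_zeta)) is at least
  -K C_F / nu_m |u - v_zeta|, and this is absorbed by the quadratic term.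

  Linearity of the weak gradient rests on its uniqueness: smooth functions exp(-c/t) give test
  functions increasing to the indicator of any box, and boxes generate the Borel sets.
*)
theory Submission
  imports Defs
begin

section \<open>The space of square integrable functions\<close>

text \<open>Functions stand for classes only implicitly. \<open>weak_gradient\<close> and
  \<open>weak_divergence\<close> are choices, and \<open>S\<close> is any map that returns some weak
  solution for each control. The gradient of a difference or the state of a convex combination is
  therefore an unrelated representative: linearity holds only almost everywhere, and only because
  uniqueness forces it. Since the integral of a nonintegrable function is zero by convention,
  membership in \<open>L2\<close> has to accompany every algebraic step.

  The product in the minorant has the following origin. Its first factor is K, the bound for the
  adjoint residual. Its second factor, up to \<open>\<nu>\<^sub>m\<close>, estimates the gradient of
  y(u) - \<eta>: the part without 1/lam is the error of \<eta> as an approximation of the state of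
  v_zeta, which is computable, while the part with 1/lam is the price of absorbing the unknown
  distance between u and v_zeta into the control cost.\<close>

definition L2inner :: "'a::euclidean_space set \<Rightarrow> ('a \<Rightarrow> 'b::euclidean_space) \<Rightarrow> ('a \<Rightarrow> 'b) \<Rightarrow> real" where
  "L2inner \<Omega> f g = (LINT x|lebesgue_on \<Omega>. f x \<bullet> g x)"

lemma L2norm_square: "(L2norm \<Omega> f)\<^sup>2 = L2inner \<Omega> f f"
  by (simp add: L2norm_def L2inner_def power2_norm_eq_inner)

lemma L2norm_nonneg [simp]: "0 \<le> L2norm \<Omega> f"
  by (simp add: L2norm_def)

lemma L2_measurable: "f \<in> L2 \<Omega> \<Longrightarrow> f \<in> borel_measurable (lebesgue_on \<Omega>)"
  by (simp add: L2_def)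

text \<open>The two functions may take values in different spaces, so a constant or a scalar
  function can dominate a vector field and conversely.\<close>

lemma L2_bound:
  fixes f :: "'a::euclidean_space \<Rightarrow> 'b::euclidean_space" and g :: "'a \<Rightarrow> 'c::euclidean_space"
  assumes "f \<in> L2 \<Omega>" "g \<in> borel_measurable (lebesgue_on \<Omega>)"
    and "AE x in lebesgue_on \<Omega>. norm (g x) \<le> C * norm (f x)"
  shows "g \<in> L2 \<Omega>"
proof -
  have "integrable (lebesgue_on \<Omega>) (\<lambda>x. (norm (g x))\<^sup>2)"
  proof (rule Bochner_Integration.integrable_bound)
    show "integrable (lebesgue_on \<Omega>) (\<lambda>x. C\<^sup>2 * (norm (f x))\<^sup>2)"
      using assms(1) by (simp add: L2_def)
    show "AE x in lebesgue_on \<Omega>. norm ((norm (g x))\<^sup>2) \<le> norm (C\<^sup>2 * (norm (f x))\<^sup>2)"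
      using assms(3)
    proof eventually_elim
      case (elim x)
      then have "(norm (g x))\<^sup>2 \<le> (C * norm (f x))\<^sup>2"
        by (intro power_mono) auto
      then show ?case by (simp add: power_mult_distrib)
    qed
  qed (use assms(2) in measurable)
  then show ?thesis
    using assms(2) by (simp add: L2_def)
qed

lemma L2_scaleR: "f \<in> L2 \<Omega> \<Longrightarrow> (\<lambda>x. c *\<^sub>R f x) \<in> L2 \<Omega>"
  by (rule L2_bound[where f = f and C = "\<bar>c\<bar>"]) (auto dest: L2_measurable)

lemma L2_add:
  fixes f g :: "'a::euclidean_space \<Rightarrow> 'b::euclidean_space"
  assumes "f \<in> L2 \<Omega>" "g \<in> L2 \<Omega>"
  shows "(\<lambda>x. f x + g x) \<in> L2 \<Omega>"
proof -
  note [measurable] = assms[THEN L2_measurable]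
  have "integrable (lebesgue_on \<Omega>) (\<lambda>x. (norm (f x + g x))\<^sup>2)"
  proof (rule Bochner_Integration.integrable_bound)
    show "integrable (lebesgue_on \<Omega>) (\<lambda>x. 2 * (norm (f x))\<^sup>2 + 2 * (norm (g x))\<^sup>2)"
      using assms by (simp add: L2_def)
    show "AE x in lebesgue_on \<Omega>.
      norm ((norm (f x + g x))\<^sup>2) \<le> norm (2 * (norm (f x))\<^sup>2 + 2 * (norm (g x))\<^sup>2)"
    proof (rule AE_I2)
      fix x
      have "(norm (f x + g x))\<^sup>2 \<le> (norm (f x) + norm (g x))\<^sup>2"
        by (intro power_mono norm_triangle_ineq) auto
      also have "\<dots> \<le> 2 * (norm (f x))\<^sup>2 + 2 * (norm (g x))\<^sup>2"
        using sum_squares_bound[of "norm (f x)" "norm (g x)"] by (simp add: power2_sum)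
      finally show "norm ((norm (f x + g x))\<^sup>2) \<le> norm (2 * (norm (f x))\<^sup>2 + 2 * (norm (g x))\<^sup>2)"
        by simp
    qed
  qed measurable
  then show ?thesis
    using assms by (simp add: L2_def)
qed

lemma L2_diff:
  assumes "f \<in> L2 \<Omega>" "g \<in> L2 \<Omega>"
  shows "(\<lambda>x. f x - g x) \<in> L2 \<Omega>"
  using L2_add[OF assms(1) L2_scaleR[OF assms(2), of "-1"]] by simp

lemma integrable_L2_inner:
  fixes f g :: "'a::euclidean_space \<Rightarrow> 'b::euclidean_space"
  assumes "f \<in> L2 \<Omega>" "g \<in> L2 \<Omega>"
  shows "integrable (lebesgue_on \<Omega>) (\<lambda>x. norm (f x) * norm (g x))"
    and "integrable (lebesgue_on \<Omega>) (\<lambda>x. f x \<bullet> g x)"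
proof -
  note [measurable] = assms[THEN L2_measurable]
  show *: "integrable (lebesgue_on \<Omega>) (\<lambda>x. norm (f x) * norm (g x))"
  proof (rule Bochner_Integration.integrable_bound)
    show "integrable (lebesgue_on \<Omega>) (\<lambda>x. (norm (f x))\<^sup>2 + (norm (g x))\<^sup>2)"
      using assms by (simp add: L2_def)
    show "AE x in lebesgue_on \<Omega>.
      norm (norm (f x) * norm (g x)) \<le> norm ((norm (f x))\<^sup>2 + (norm (g x))\<^sup>2)"
    proof (rule AE_I2)
      fix x
      have "norm (f x) * norm (g x) \<le> (norm (f x))\<^sup>2 + (norm (g x))\<^sup>2"
        using sum_squares_bound[of "norm (f x)" "norm (g x)"]
          mult_nonneg_nonneg[OF norm_ge_zero[of "f x"] norm_ge_zero[of "g x"]] by linarith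
      then show "norm (norm (f x) * norm (g x)) \<le> norm ((norm (f x))\<^sup>2 + (norm (g x))\<^sup>2)"
        by (simp add: abs_mult)
    qed
  qed measurable
  show "integrable (lebesgue_on \<Omega>) (\<lambda>x. f x \<bullet> g x)"
    by (rule Bochner_Integration.integrable_bound[OF *])
      (auto simp: abs_mult Cauchy_Schwarz_ineq2)
qed

lemma L2inner_add_left:
  "f \<in> L2 \<Omega> \<Longrightarrow> g \<in> L2 \<Omega> \<Longrightarrow> h \<in> L2 \<Omega> \<Longrightarrow>
    L2inner \<Omega> (\<lambda>x. f x + g x) h = L2inner \<Omega> f h + L2inner \<Omega> g h"
  by (simp add: L2inner_def inner_add_left integrable_L2_inner)

lemma L2inner_diff_left:
  "f \<in> L2 \<Omega> \<Longrightarrow> g \<in> L2 \<Omega> \<Longrightarrow> h \<in> L2 \<Omega> \<Longrightarrow>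
    L2inner \<Omega> (\<lambda>x. f x - g x) h = L2inner \<Omega> f h - L2inner \<Omega> g h"
  by (simp add: L2inner_def inner_diff_left integrable_L2_inner)

lemma L2inner_commute: "L2inner \<Omega> f g = L2inner \<Omega> g f"
  by (simp add: L2inner_def inner_commute)

lemma L2inner_scaleR_left: "L2inner \<Omega> (\<lambda>x. c *\<^sub>R f x) g = c * L2inner \<Omega> f g"
  by (simp add: L2inner_def)

lemma L2inner_add_right:
  "f \<in> L2 \<Omega> \<Longrightarrow> g \<in> L2 \<Omega> \<Longrightarrow> h \<in> L2 \<Omega> \<Longrightarrow>
    L2inner \<Omega> h (\<lambda>x. f x + g x) = L2inner \<Omega> h f + L2inner \<Omega> h g"
  by (simp add: L2inner_add_left L2inner_commute[of _ h])

lemma L2inner_diff_right: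
  "f \<in> L2 \<Omega> \<Longrightarrow> g \<in> L2 \<Omega> \<Longrightarrow> h \<in> L2 \<Omega> \<Longrightarrow>
    L2inner \<Omega> h (\<lambda>x. f x - g x) = L2inner \<Omega> h f - L2inner \<Omega> h g"
  by (simp add: L2inner_diff_left L2inner_commute[of _ h])

lemma L2inner_scaleR_right: "L2inner \<Omega> f (\<lambda>x. c *\<^sub>R g x) = c * L2inner \<Omega> f g"
  by (simp add: L2inner_def)

text \<open>The entry point for identities between chosen representatives, which are known almost
  everywhere only.\<close>

lemma L2inner_AE_cong:
  assumes "f \<in> L2 \<Omega>" "f' \<in> L2 \<Omega>" "g \<in> L2 \<Omega>" "g' \<in> L2 \<Omega>"
    and "AE x in lebesgue_on \<Omega>. f x = f' x" "AE x in lebesgue_on \<Omega>. g x = g' x"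
  shows "L2inner \<Omega> f g = L2inner \<Omega> f' g'"
  unfolding L2inner_def
proof (rule integral_cong_AE)
  show "AE x in lebesgue_on \<Omega>. f x \<bullet> g x = f' x \<bullet> g' x"
    using assms(5,6) by eventually_elim simp
qed (use assms in \<open>auto dest!: L2_measurable\<close>)

lemma L2norm_AE_cong:
  assumes "f \<in> L2 \<Omega>" "g \<in> L2 \<Omega>" "AE x in lebesgue_on \<Omega>. f x = g x"
  shows "L2norm \<Omega> f = L2norm \<Omega> g"
  using L2inner_AE_cong[OF assms(1,2,1,2) assms(3,3)]
  by (metis L2norm_nonneg L2norm_square power2_eq_imp_eq)

lemma L2norm_scaleR: "L2norm \<Omega> (\<lambda>x. c *\<^sub>R f x) = \<bar>c\<bar> * L2norm \<Omega> f"
proof -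
  have "(L2norm \<Omega> (\<lambda>x. c *\<^sub>R f x))\<^sup>2 = (\<bar>c\<bar> * L2norm \<Omega> f)\<^sup>2"
    by (simp add: L2norm_square L2inner_scaleR_left L2inner_scaleR_right power_mult_distrib)
      (simp add: power2_eq_square)
  then show ?thesis
    by (simp add: power2_eq_imp_eq)
qed

lemma L2norm_add_square:
  assumes "f \<in> L2 \<Omega>" "g \<in> L2 \<Omega>"
  shows "(L2norm \<Omega> (\<lambda>x. f x + g x))\<^sup>2 = (L2norm \<Omega> f)\<^sup>2 + 2 * L2inner \<Omega> f g + (L2norm \<Omega> g)\<^sup>2"
  using assms
  by (simp add: L2norm_square L2inner_add_left L2inner_add_right L2_add L2inner_commute[of _ g f])

text \<open>The squared norm of f + t g is a nonnegative quadratic in t; evaluating it at its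
  minimiser -b / c gives the claim when the leading coefficient c is positive.\<close>

lemma L2_Cauchy_Schwarz:
  assumes "f \<in> L2 \<Omega>" "g \<in> L2 \<Omega>"
  shows "\<bar>L2inner \<Omega> f g\<bar> \<le> L2norm \<Omega> f * L2norm \<Omega> g"
proof -
  let ?a = "(L2norm \<Omega> f)\<^sup>2" and ?b = "L2inner \<Omega> f g" and ?c = "(L2norm \<Omega> g)\<^sup>2"
  have quad: "0 \<le> ?a + 2 * t * ?b + t\<^sup>2 * ?c" for t
    using L2norm_add_square[OF assms(1) L2_scaleR[OF assms(2), of t]]
      zero_le_power2[of "L2norm \<Omega> (\<lambda>x. f x + t *\<^sub>R g x)"]
    by (simp add: L2inner_scaleR_right L2norm_scaleR power_mult_distrib)
  have "?b\<^sup>2 \<le> ?a * ?c"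
  proof (cases "?c = 0")
    case True
    have "?b = 0"
    proof (rule ccontr)
      assume "?b \<noteq> 0"
      \<comment> \<open>With c = 0 the polynomial is affine in t, and this t is where it takes the
        value -1.\<close>
      moreover have "0 \<le> ?a + 2 * (- (?a + 1) / (2 * ?b)) * ?b"
        using quad[of "- (?a + 1) / (2 * ?b)"] True by simp
      ultimately show False by (simp add: field_simps)
    qed
    then show ?thesis by simp
  next
    case False
    then have c: "?c > 0" by (simp add: less_le)
    have "0 \<le> ?a + 2 * (- ?b / ?c) * ?b + (- ?b / ?c)\<^sup>2 * ?c" by (rule quad)
    also have "\<dots> = ?a - ?b\<^sup>2 / ?c"
      using c by (simp add: power2_eq_square field_simps)
    finally show ?thesis
      using c by (simp add: field_simps)
  qed
  then have "\<bar>?b\<bar>\<^sup>2 \<le> (L2norm \<Omega> f * L2norm \<Omega> g)\<^sup>2"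
    by (simp add: power_mult_distrib)
  then show ?thesis
    by (rule power2_le_imp_le) simp
qed

lemma L2norm_triangle:
  assumes "f \<in> L2 \<Omega>" "g \<in> L2 \<Omega>"
  shows "L2norm \<Omega> (\<lambda>x. f x + g x) \<le> L2norm \<Omega> f + L2norm \<Omega> g"
proof (rule power2_le_imp_le)
  show "(L2norm \<Omega> (\<lambda>x. f x + g x))\<^sup>2 \<le> (L2norm \<Omega> f + L2norm \<Omega> g)\<^sup>2"
    using L2norm_add_square[OF assms] L2_Cauchy_Schwarz[OF assms]
    by (simp add: power2_sum)
qed simp


text \<open>Weak gradients are defined through vector-valued integrals, which the inner product
  lemmas do not reach.\<close>

lemma integrable_L2_scaleR:
  fixes f :: "'a::euclidean_space \<Rightarrow> real" and G :: "'a \<Rightarrow> 'b::euclidean_space"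
  assumes f: "f \<in> L2 \<Omega>" and G: "G \<in> L2 \<Omega>"
  shows "integrable (lebesgue_on \<Omega>) (\<lambda>x. f x *\<^sub>R G x)"
proof -
  note [measurable] = L2_measurable[OF f] L2_measurable[OF G]
  have "(\<lambda>x. norm (G x)) \<in> L2 \<Omega>"
    by (rule L2_bound[OF G, where C = 1]) auto
  from integrable_L2_inner(1)[OF f this] show ?thesis
    by (rule Bochner_Integration.integrable_bound) auto
qed

lemma L2_linear:
  fixes f g :: "'a::euclidean_space \<Rightarrow> 'b::euclidean_space"
  assumes "f \<in> L2 \<Omega>" "g \<in> L2 \<Omega>"
  shows "(\<lambda>x. a *\<^sub>R f x + b *\<^sub>R g x) \<in> L2 \<Omega>"
  using assms by (intro L2_add L2_scaleR)

lemma L2_linear_real: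
  fixes f g :: "'a::euclidean_space \<Rightarrow> real"
  assumes "f \<in> L2 \<Omega>" "g \<in> L2 \<Omega>"
  shows "(\<lambda>x. a * f x + b * g x) \<in> L2 \<Omega>"
  using L2_linear[OF assms, of a b] by simp

lemma L2norm_linear_le:
  fixes f g :: "'a::euclidean_space \<Rightarrow> 'b::euclidean_space"
  assumes "f \<in> L2 \<Omega>" "g \<in> L2 \<Omega>"
  shows "L2norm \<Omega> (\<lambda>x. a *\<^sub>R f x + b *\<^sub>R g x) \<le> \<bar>a\<bar> * L2norm \<Omega> f + \<bar>b\<bar> * L2norm \<Omega> g"
  using L2norm_triangle[OF L2_scaleR[OF assms(1), of a] L2_scaleR[OF assms(2), of b]]
  by (simp add: L2norm_scaleR)

text \<open>Stated as an identity rather than a convexity inequality, because the defect with factor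
  t (1 - t) is what later becomes the error measure.\<close>

lemma L2norm_convex_combination:
  fixes p q :: "'a::euclidean_space \<Rightarrow> 'b::euclidean_space"
  assumes p: "p \<in> L2 \<Omega>" and q: "q \<in> L2 \<Omega>"
  shows "(L2norm \<Omega> (\<lambda>x. (1 - t) *\<^sub>R p x + t *\<^sub>R q x))\<^sup>2
    = (1 - t) * (L2norm \<Omega> p)\<^sup>2 + t * (L2norm \<Omega> q)\<^sup>2 - t * (1 - t) * (L2norm \<Omega> (\<lambda>x. p x - q x))\<^sup>2"
proof -
  have comb: "(L2norm \<Omega> (\<lambda>x. (1 - t) *\<^sub>R p x + t *\<^sub>R q x))\<^sup>2
      = (1 - t)\<^sup>2 * (L2norm \<Omega> p)\<^sup>2 + 2 * ((1 - t) * t * L2inner \<Omega> p q) + t\<^sup>2 * (L2norm \<Omega> q)\<^sup>2"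
    by (simp add: L2norm_add_square[OF L2_scaleR[OF p] L2_scaleR[OF q]] L2norm_scaleR
        power_mult_distrib L2inner_scaleR_left L2inner_scaleR_right)
  have diff: "(L2norm \<Omega> (\<lambda>x. p x - q x))\<^sup>2 = (L2norm \<Omega> p)\<^sup>2 - 2 * L2inner \<Omega> p q + (L2norm \<Omega> q)\<^sup>2"
    by (simp add: L2norm_square L2inner_diff_left L2inner_diff_right L2_diff p q
        L2inner_commute[of _ q p])
  show ?thesis
    unfolding comb diff by (simp add: algebra_simps power2_eq_square)
qed

lemma L2norm_eq_0_AE:
  assumes "f \<in> L2 \<Omega>" "L2norm \<Omega> f = 0"
  shows "AE x in lebesgue_on \<Omega>. f x = 0"
proof -
  have "(LINT x|lebesgue_on \<Omega>. (norm (f x))\<^sup>2) = 0"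
    using assms(2) by (simp add: L2norm_def)
  then have "AE x in lebesgue_on \<Omega>. (norm (f x))\<^sup>2 = 0"
    using assms(1) by (subst (asm) integral_nonneg_eq_0_iff_AE) (auto simp: L2_def)
  then show ?thesis by eventually_elim simp
qed

section \<open>Test functions and the fundamental lemma of the calculus of variations\<close>

text \<open>The Borel sets over which g integrates to zero form a Dynkin system, and the boxes are a
  generator closed under intersections. The integral over the whole space is a separate assumption
  because complements need it and the space is not itself a box.\<close>

lemma AE_zero_if_box_integrals_zero:
  fixes g :: "'a::euclidean_space \<Rightarrow> real"
  assumes g: "integrable lborel g" and "(LINT x|lborel. g x) = 0"
    and box: "\<And>a b. (LINT x|lborel. indicator (box a b) x *\<^sub>R g x) = 0"
  shows "AE x in lborel. g x = 0"
proof (rule sigma_finite_measure.density_zero[OF lborel.sigma_finite_measure_axioms g])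
  fix A :: "'a set"
  assume A: "A \<in> sets lborel"
  have "Int_stable (range (\<lambda>(a, b). box a b :: 'a set))"
    by (auto simp: Int_stable_def box_Int_box)
  moreover have "range (\<lambda>(a, b). box a b :: 'a set) \<subseteq> Pow UNIV"
    by auto
  moreover have "A \<in> sigma_sets UNIV (range (\<lambda>(a, b). box a b))"
    using A unfolding sets_lborel borel_eq_box by simp
  ultimately have "(LINT x|lborel. indicator A x *\<^sub>R g x) = 0"
  proof (induction rule: sigma_sets_induct_disjoint)
    case (compl A)
    then have [measurable]: "A \<in> sets borel" by (simp add: borel_eq_box)
    have int: "integrable lborel (\<lambda>x. indicator A x *\<^sub>R g x)"
      by (intro integrable_mult_indicator g) simp
    have "(LINT x|lborel. indicator (UNIV - A) x *\<^sub>R g x)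
        = (LINT x|lborel. g x - indicator A x *\<^sub>R g x)"
      by (intro Bochner_Integration.integral_cong) (auto split: split_indicator)
    also have "\<dots> = 0"
      using compl assms(2) g int by simp
    finally show ?case .
  next
    case (union F)
    then have [measurable]: "F i \<in> sets borel" for i
      by (simp add: borel_eq_box subset_eq)
    have "(LINT x:(\<Union>i. F i)|lborel. g x) = (\<Sum>i. LINT x:F i|lborel. g x)"
    proof (rule lebesgue_integral_countable_add)
      show "F i \<inter> F j = {}" if "i \<noteq> j" for i j
        using union(1) that by (auto simp: disjoint_family_on_def)
      show "set_integrable lborel (\<Union>i. F i) g"
        unfolding set_integrable_def by (intro integrable_mult_indicator g) simp
    qed simp
    then show ?case
      using union(3) by (simp add: set_lebesgue_integral_def)
  qed (use box in auto)
  then show "set_lebesgue_integral lborel A g = 0"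
    by (simp add: set_lebesgue_integral_def)
qed

section \<open>Calculus of smooth functions\<close>

text \<open>Gradients can thus be read off from any derivative that the calculus rules exhibit,
  instead of the one chosen by \<open>frechet_derivative\<close>.\<close>

lemma gradient_inner:
  assumes "(\<phi> has_derivative D) (at x)" "i \<in> Basis"
  shows "gradient \<phi> x \<bullet> i = D i"
  using assms(2) frechet_derivative_at[OF assms(1)]
  by (simp add: gradient_def inner_sum_left inner_Basis if_distrib sum.delta cong: if_cong)

text \<open>The product rule multiplies one factor, undifferentiated, by a derivative of the other;
  this brings both down to the same order.\<close>

lemma times_continuously_differentiable_SucD:
  "times_continuously_differentiable (Suc k) \<phi> \<Longrightarrow> times_continuously_differentiable k \<phi>"
proof (induction k arbitrary: \<phi>)
  case 0
  then show ?case
    by (auto simp: continuous_on_eq_continuous_at intro: differentiable_imp_continuous_within)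
qed auto

lemma times_continuously_differentiable_const:
  "times_continuously_differentiable k (\<lambda>x::'a::euclidean_space. c)"
proof (induction k arbitrary: c)
  case (Suc k)
  have "gradient (\<lambda>x::'a. c) x \<bullet> i = 0" if "i \<in> Basis" for x i
    using that by (intro gradient_inner) auto
  then show ?case using Suc by auto
qed auto

lemma times_continuously_differentiable_add:
  fixes f g :: "'a::euclidean_space \<Rightarrow> real"
  assumes "times_continuously_differentiable k f" "times_continuously_differentiable k g"
  shows "times_continuously_differentiable k (\<lambda>x. f x + g x)"
  using assms
proof (induction k arbitrary: f g)
  case 0
  then show ?case by (auto intro: continuous_on_add)
next
  case (Suc k)
  have "(\<lambda>x. gradient (\<lambda>x. f x + g x) x \<bullet> i) = (\<lambda>x. gradient f x \<bullet> i + gradient g x \<bullet> i)"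
    if "i \<in> Basis" for i
  proof
    fix x
    have f: "(f has_derivative frechet_derivative f (at x)) (at x)"
      and g: "(g has_derivative frechet_derivative g (at x)) (at x)"
      using Suc.prems by (simp_all add: frechet_derivative_works)
    show "gradient (\<lambda>x. f x + g x) x \<bullet> i = gradient f x \<bullet> i + gradient g x \<bullet> i"
      by (simp only: gradient_inner[OF f that] gradient_inner[OF g that]
          gradient_inner[OF has_derivative_add[OF f g] that])
  qed
  then show ?case
    using Suc by auto
qed

lemma times_continuously_differentiable_mult:
  fixes f g :: "'a::euclidean_space \<Rightarrow> real"
  assumes "times_continuously_differentiable k f" "times_continuously_differentiable k g"
  shows "times_continuously_differentiable k (\<lambda>x. f x * g x)"
  using assms
proof (induction k arbitrary: f g)
  case 0
  then show ?case by (auto intro: continuous_on_mult)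
next
  case (Suc k)
  have "(\<lambda>x. gradient (\<lambda>x. f x * g x) x \<bullet> i) = (\<lambda>x. f x * (gradient g x \<bullet> i) + (gradient f x \<bullet> i) * g x)"
    if "i \<in> Basis" for i
  proof
    fix x
    have f: "(f has_derivative frechet_derivative f (at x)) (at x)"
      and g: "(g has_derivative frechet_derivative g (at x)) (at x)"
      using Suc.prems by (simp_all add: frechet_derivative_works)
    show "gradient (\<lambda>x. f x * g x) x \<bullet> i = f x * (gradient g x \<bullet> i) + (gradient f x \<bullet> i) * g x"
      by (simp only: gradient_inner[OF f that] gradient_inner[OF g that]
          gradient_inner[OF has_derivative_mult[OF f g] that])
  qed
  moreover have "times_continuously_differentiable k f" "times_continuously_differentiable k g"
    using Suc.prems times_continuously_differentiable_SucD by blast+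
  ultimately show ?case
    using Suc by (auto intro!: times_continuously_differentiable_add)
qed

lemma times_continuously_differentiable_prod:
  assumes "\<And>i. i \<in> I \<Longrightarrow> times_continuously_differentiable k (f i)"
  shows "times_continuously_differentiable k (\<lambda>x. \<Prod>i\<in>I. f i x)"
  using assms
  by (induction I rule: infinite_finite_induct)
    (auto simp: times_continuously_differentiable_const times_continuously_differentiable_mult)

text \<open>A smooth function of one variable is given together with all its derivatives as a
  sequence H. One differentiation then only shifts the index and contributes the constant
  \<open>v \<bullet> i\<close>, so no chain rule of higher order arises; for this n must stay
  arbitrary in the induction on k.\<close>

lemma times_continuously_differentiable_compose_inner:
  fixes H :: "nat \<Rightarrow> real \<Rightarrow> real"
  assumes H: "\<And>n t. (H n has_real_derivative H (Suc n) t) (at t)"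
  shows "times_continuously_differentiable k (\<lambda>x. H n (v \<bullet> x + d))"
proof (induction k arbitrary: n)
  case 0
  have "isCont (H n) t" for t
    using H DERIV_isCont by blast
  then have "continuous_on UNIV (H n)"
    by (simp add: continuous_on_eq_continuous_at)
  then have "continuous_on UNIV (\<lambda>x. H n (v \<bullet> x + d))"
    by (rule continuous_on_compose2) (auto intro!: continuous_intros)
  then show ?case by simp
next
  case (Suc k)
  have D: "((\<lambda>x. H n (v \<bullet> x + d)) has_derivative (\<lambda>h. (v \<bullet> h) * H (Suc n) (v \<bullet> x + d))) (at x)" for x
    by (rule has_derivative_eq_rhs, rule DERIV_compose_FDERIV[OF H], (rule derivative_intros)+) simp
  have "(\<lambda>x. gradient (\<lambda>x. H n (v \<bullet> x + d)) x \<bullet> i) = (\<lambda>x. (v \<bullet> i) * H (Suc n) (v \<bullet> x + d))"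
    if "i \<in> Basis" for i
    using gradient_inner[OF D that] by simp
  then show ?case
    using D by (auto simp: differentiable_def intro!: Suc times_continuously_differentiable_mult
        times_continuously_differentiable_const)
qed

section \<open>The flat function exp (- c / t) and smooth bumps on boxes\<close>

text \<open>The power of u is there for the induction on P: splitting off the constant coefficient
  leaves u times a shorter polynomial, which raises k by one.\<close>

lemma poly_mult_exp_tendsto_0:
  fixes P :: "real poly"
  assumes c: "c > 0"
  shows "((\<lambda>u. u ^ k * poly P u * exp (- (c * u))) \<longlongrightarrow> 0) at_top"
proof (induction P arbitrary: k)
  case (pCons a P)
  have "((\<lambda>x. x ^ k / exp x) \<longlongrightarrow> (0::real)) at_top"
    by (rule tendsto_power_div_exp_0)
  moreover have "filterlim (\<lambda>u. c * u) at_top at_top"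
    using c by (intro filterlim_tendsto_pos_mult_at_top[OF tendsto_const _ filterlim_ident])
  ultimately have "((\<lambda>u. (c * u) ^ k / exp (c * u)) \<longlongrightarrow> 0) at_top"
    by (rule filterlim_compose)
  then have "((\<lambda>u. a / c ^ k * ((c * u) ^ k / exp (c * u)) + u ^ Suc k * poly P u * exp (- (c * u)))
      \<longlongrightarrow> a / c ^ k * 0 + 0) at_top"
    by (intro tendsto_intros pCons)
  moreover have "a / c ^ k * ((c * u) ^ k / exp (c * u)) + u ^ Suc k * poly P u * exp (- (c * u))
      = u ^ k * poly (pCons a P) u * exp (- (c * u))" for u
    using c by (simp add: power_mult_distrib exp_minus field_simps)
  ultimately show ?case by simp
qed simp

text \<open>The polynomial in 1/t makes the family closed under differentiation. The parameter c is
  kept free because bumps are sharpened by sending it to 0.\<close>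

definition flat :: "real \<Rightarrow> real poly \<Rightarrow> real \<Rightarrow> real" where
  "flat c P t = (if 0 < t then poly P (inverse t) * exp (- (c * inverse t)) else 0)"

(* The n-th derivative of exp (- c / t) on t > 0 is poly (flat_poly c n) (1 / t) * exp (- c / t). *)
primrec flat_poly :: "real \<Rightarrow> nat \<Rightarrow> real poly" where
  "flat_poly c 0 = 1"
| "flat_poly c (Suc n) = [:0, 0, 1:] * (smult c (flat_poly c n) - pderiv (flat_poly c n))"

text \<open>With s = 1/t one has ds/dt = - s^2, which accounts for the factor
  \<open>[:0, 0, 1:]\<close> and for the sign of \<open>pderiv P\<close>. Away from 0 this is the
  ordinary product rule; at 0 the difference quotient is examined from both sides.\<close>

lemma flat_has_derivative:
  assumes c: "c > 0"
  shows "(flat c P has_real_derivative flat c ([:0, 0, 1:] * (smult c P - pderiv P)) t) (at t)"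
proof -
  consider "t < 0" | "t = 0" | "t > 0" by linarith
  then show ?thesis
  proof cases
    case 1
    have "((\<lambda>_. 0) has_real_derivative 0) (at t)" by simp
    then have "(flat c P has_real_derivative 0) (at t)"
    proof (rule has_field_derivative_transform_within_open[where S = "{..<0}"])
      show "\<And>x. x \<in> {..<0} \<Longrightarrow> 0 = flat c P x" by (simp add: flat_def)
    qed (use 1 in auto)
    then show ?thesis using 1 by (simp add: flat_def)
  next
    case 2
    \<comment> \<open>Substituting h = 1/u moves the limit from 0+ to infinity; the power 1 is the
      factor 1/h of the difference quotient.\<close>
    have "((\<lambda>u. u ^ 1 * poly P u * exp (- (c * u))) \<longlongrightarrow> 0) at_top"
      by (rule poly_mult_exp_tendsto_0[OF c])
    then have "((\<lambda>h. flat c P h / h) \<longlongrightarrow> 0) (at_right 0)"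
      unfolding filterlim_at_right_to_top
    proof (rule Lim_transform_eventually)
      show "eventually (\<lambda>u. u ^ 1 * poly P u * exp (- (c * u)) = flat c P (inverse u) / inverse u) at_top"
        using eventually_gt_at_top[of "0::real"]
        by eventually_elim (simp add: flat_def field_simps)
    qed
    moreover have "((\<lambda>h. flat c P h / h) \<longlongrightarrow> 0) (at_left 0)"
    proof (rule Lim_transform_eventually[OF tendsto_const])
      show "eventually (\<lambda>h. 0 = flat c P h / h) (at_left 0)"
        by (auto simp: eventually_at_filter flat_def)
    qed
    ultimately have "((\<lambda>h. flat c P h / h) \<longlongrightarrow> 0) (at 0)"
      by (rule filterlim_split_at[rotated])
    then show ?thesis
      using 2 by (simp add: has_field_derivative_def[symmetric] DERIV_def flat_def)
  next
    case 3
    have "((\<lambda>t. poly P (inverse t) * exp (- (c * inverse t))) has_real_derivative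
        flat c ([:0, 0, 1:] * (smult c P - pderiv P)) t) (at t)"
      using 3 by (auto intro!: derivative_eq_intros DERIV_chain'[OF _ poly_DERIV]
          simp: flat_def algebra_simps power2_eq_square)
    then show ?thesis
    proof (rule has_field_derivative_transform_within_open[where S = "{0<..}"])
      show "\<And>x. x \<in> {0<..} \<Longrightarrow> poly P (inverse x) * exp (- (c * inverse x)) = flat c P x"
        by (simp add: flat_def)
    qed (use 3 in auto)
  qed
qed

lemma times_continuously_differentiable_flat:
  assumes "c > 0"
  shows "times_continuously_differentiable k (\<lambda>x. flat c 1 (v \<bullet> x + d))"
  using times_continuously_differentiable_compose_inner[where H = "\<lambda>n. flat c (flat_poly c n)" and n = 0]
    flat_has_derivative[OF assms] by simp

text \<open>For each coordinate two flat factors are taken, one in the distance to each face. Their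
  product is positive exactly on the open box whatever c is, so supports stay inside the closed box,
  while c = 1/(n+1) tending to 0 pushes the value at each interior point up to 1.\<close>

lemma box_bump_sequence:
  fixes a b :: "'a::euclidean_space"
  assumes "cbox a b \<subseteq> \<Omega>"
  obtains \<phi> :: "nat \<Rightarrow> 'a \<Rightarrow> real" where "\<And>n. \<phi> n \<in> test_functions \<Omega>"
    and "\<And>n x. \<bar>\<phi> n x\<bar> \<le> 1" and "\<And>x. (\<lambda>n. \<phi> n x) \<longlonglongrightarrow> indicator (box a b) x"
proof
  define \<phi> :: "nat \<Rightarrow> 'a \<Rightarrow> real" where "\<phi> = (\<lambda>n x. \<Prod>i\<in>Basis.
    flat (inverse (Suc n)) 1 (i \<bullet> x + - (a \<bullet> i)) * flat (inverse (Suc n)) 1 ((- i) \<bullet> x + b \<bullet> i))"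
  have nz: "\<phi> n x \<noteq> 0 \<longleftrightarrow> x \<in> box a b" for n x
    by (auto simp: \<phi>_def flat_def box_def inner_commute)
  have flat01: "0 \<le> flat (inverse (Suc n)) 1 t \<and> flat (inverse (Suc n)) 1 t \<le> 1" for n t
    by (auto simp: flat_def)
  show "\<bar>\<phi> n x\<bar> \<le> 1" for n x
    unfolding \<phi>_def abs_prod abs_mult
    using flat01 by (intro prod_le_1) (auto intro!: mult_le_one)
  show "\<phi> n \<in> test_functions \<Omega>" for n
  proof -
    have sub: "closure {x. \<phi> n x \<noteq> 0} \<subseteq> cbox a b"
      unfolding nz by (simp add: closure_minimal box_subset_cbox closed_cbox)
    then have "compact (closure {x. \<phi> n x \<noteq> 0})"
      by (meson bounded_cbox bounded_subset closed_closure compact_eq_bounded_closed)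
    moreover have "times_continuously_differentiable k (\<phi> n)" for k
      unfolding \<phi>_def
      by (intro times_continuously_differentiable_prod times_continuously_differentiable_mult
          times_continuously_differentiable_flat) auto
    ultimately show ?thesis
      using sub assms by (auto simp: test_functions_def)
  qed
  show "(\<lambda>n. \<phi> n x) \<longlonglongrightarrow> indicator (box a b) x" for x
  proof (cases "x \<in> box a b")
    case False
    then have "\<phi> n x = 0" for n using nz by blast
    then show ?thesis using False by simp
  next
    case True
    have flat_lim: "(\<lambda>n. flat (inverse (Suc n)) 1 t) \<longlonglongrightarrow> 1" if "t > 0" for t
    proof -
      have "(\<lambda>n. exp (- (inverse (real (Suc n)) * inverse t))) \<longlonglongrightarrow> exp (- (0 * inverse t))"
        by (intro tendsto_intros LIMSEQ_inverse_real_of_nat)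
      then show ?thesis using that by (simp add: flat_def)
    qed
    have "(\<lambda>n. \<phi> n x) \<longlonglongrightarrow> (\<Prod>i\<in>(Basis::'a set). 1 * 1)"
      unfolding \<phi>_def
      using True by (intro tendsto_prod tendsto_mult flat_lim) (auto simp: box_def inner_commute)
    then show ?thesis using True by simp
  qed
qed

lemma test_function_continuous: "\<phi> \<in> test_functions \<Omega> \<Longrightarrow> continuous_on UNIV \<phi>"
  using times_continuously_differentiable.simps(1) unfolding test_functions_def by blast

lemma continuous_borel_measurable_lebesgue_on:
  fixes f :: "'a::euclidean_space \<Rightarrow> 'b::euclidean_space"
  assumes "continuous_on UNIV f"
  shows "f \<in> borel_measurable (lebesgue_on \<Omega>)"
  using borel_measurable_continuous_onI[OF assms]
  by (intro measurable_restrict_space1 measurable_completion) simp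

text \<open>Indicators are limits of test functions only for boxes whose closure lies in \<Omega>.
  Hence g is shown to vanish on each such box, after dominated convergence with majorant |g|, and a
  countable cover of \<Omega> by closed boxes does the rest.\<close>

lemma AE_zero_if_test_integrals_zero:
  fixes g :: "'a::euclidean_space \<Rightarrow> real"
  assumes "open \<Omega>" and g: "integrable (lebesgue_on \<Omega>) g"
    and test: "\<And>\<phi>. \<phi> \<in> test_functions \<Omega> \<Longrightarrow> (LINT x|lebesgue_on \<Omega>. \<phi> x * g x) = 0"
  shows "AE x in lebesgue_on \<Omega>. g x = 0"
proof -
  have \<Omega>: "\<Omega> \<inter> space lebesgue \<in> sets lebesgue"
    using \<open>open \<Omega>\<close> by auto
  define G where "G = (\<lambda>x. indicator \<Omega> x *\<^sub>R g x)"
  have G: "integrable lebesgue G"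
    using g unfolding G_def integrable_restrict_space[OF \<Omega>] .
  then have "G \<in> borel_measurable lebesgue" by simp
  \<comment> \<open>Boxes generate the Borel sets and not the Lebesgue sets, so the argument runs on
    a Borel representative of the extension by zero.\<close>
  then obtain G' where G'_meas [measurable]: "G' \<in> borel_measurable lborel"
    and eq: "AE x in lborel. G x = G' x"
    using completion_ex_borel_measurable_real by blast
  have G'_meas' [measurable]: "G' \<in> borel_measurable lebesgue"
    by (rule measurable_completion) fact
  have "integrable lebesgue G'"
    by (rule integrable_cong_AE_imp[OF G]) (use eq AE_completion in \<open>auto intro: AE_symmetric\<close>)
  then have G': "integrable lborel G'"
    by (simp add: integrable_completion)
  have box: "(LINT x|lborel. indicator (box a b) x *\<^sub>R G' x) = 0" if sub: "cbox a b \<subseteq> \<Omega>" for a b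
  proof -
    obtain \<phi> :: "nat \<Rightarrow> 'a \<Rightarrow> real" where \<phi>: "\<And>n. \<phi> n \<in> test_functions \<Omega>"
      "\<And>n x. \<bar>\<phi> n x\<bar> \<le> 1" "\<And>x. (\<lambda>n. \<phi> n x) \<longlonglongrightarrow> indicator (box a b) x"
      using box_bump_sequence[OF sub] by blast
    have [measurable]: "\<phi> n \<in> borel_measurable (lebesgue_on \<Omega>)" for n
      using \<phi>(1) by (intro continuous_borel_measurable_lebesgue_on test_function_continuous)
    have [measurable]: "indicat_real (box a b) \<in> borel_measurable (lebesgue_on \<Omega>)"
      using \<phi>(3) by (rule borel_measurable_LIMSEQ_metric[rotated]) measurable
    note [measurable] = borel_measurable_integrable[OF g]
    have "(\<lambda>n. LINT x|lebesgue_on \<Omega>. \<phi> n x * g x)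
        \<longlonglongrightarrow> (LINT x|lebesgue_on \<Omega>. indicator (box a b) x * g x)"
    proof (rule integral_dominated_convergence)
      show "integrable (lebesgue_on \<Omega>) (\<lambda>x. \<bar>g x\<bar>)"
        using g by simp
      show "AE x in lebesgue_on \<Omega>. (\<lambda>n. \<phi> n x * g x) \<longlonglongrightarrow> indicator (box a b) x * g x"
        by (intro AE_I2 tendsto_mult \<phi>(3) tendsto_const)
      show "AE x in lebesgue_on \<Omega>. norm (\<phi> n x * g x) \<le> \<bar>g x\<bar>" for n
        using \<phi>(2) by (simp add: abs_mult mult_left_le_one_le)
    qed measurable
    then have "(LINT x|lebesgue_on \<Omega>. indicator (box a b) x * g x) = 0"
      by (simp add: test \<phi>(1) LIMSEQ_const_iff)
    also have "(LINT x|lebesgue_on \<Omega>. indicator (box a b) x * g x)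
        = (LINT x|lebesgue. indicator (box a b) x *\<^sub>R G x)"
      by (simp add: integral_restrict_space[OF \<Omega>] G_def mult_ac)
    also have "\<dots> = (LINT x|lebesgue. indicator (box a b) x *\<^sub>R G' x)"
    proof (rule integral_cong_AE)
      show "AE x in lebesgue. indicator (box a b) x *\<^sub>R G x = indicator (box a b) x *\<^sub>R G' x"
        using AE_completion[OF eq] by eventually_elim simp
      show "(\<lambda>x. indicator (box a b) x *\<^sub>R G x) \<in> borel_measurable lebesgue"
        using G by (intro borel_measurable_integrable integrable_mult_indicator) auto
      show "(\<lambda>x. indicator (box a b) x *\<^sub>R G' x) \<in> borel_measurable lebesgue"
        using \<open>integrable lebesgue G'\<close> by (intro borel_measurable_integrable integrable_mult_indicator) auto
    qed
    also have "\<dots> = (LINT x|lborel. indicator (box a b) x *\<^sub>R G' x)"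
      by (rule integral_completion) measurable
    finally show ?thesis by simp
  qed
  have zero: "AE x in lebesgue. x \<in> cbox c d \<longrightarrow> G x = 0" if sub: "cbox c d \<subseteq> \<Omega>" for c d
  proof -
    have "AE x in lborel. indicator (box c d) x *\<^sub>R G' x = 0"
    proof (rule AE_zero_if_box_integrals_zero)
      show "integrable lborel (\<lambda>x. indicator (box c d) x *\<^sub>R G' x)"
        using G' by (rule integrable_mult_indicator[rotated]) simp
      show "(LINT x|lborel. indicator (box c d) x *\<^sub>R G' x) = 0"
        by (rule box[OF sub])
      show "(LINT x|lborel. indicator (box a b) x *\<^sub>R indicator (box c d) x *\<^sub>R G' x) = 0" for a b
      proof -
        \<comment> \<open>Corners of the intersection of the two boxes. Cutting off with
          \<open>box c d\<close> keeps every box that has to be tested inside \<Omega>.\<close>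
        define p q where "p = (\<Sum>i\<in>Basis. max (a \<bullet> i) (c \<bullet> i) *\<^sub>R i)"
          and "q = (\<Sum>i\<in>Basis. min (b \<bullet> i) (d \<bullet> i) *\<^sub>R i)"
        have "cbox p q \<subseteq> \<Omega>"
          using sub Int_interval[of a b c d] by (auto simp: p_def q_def)
        moreover have "indicator (box a b) x *\<^sub>R indicator (box c d) x *\<^sub>R G' x
            = indicator (box p q) x *\<^sub>R G' x" for x
          using box_Int_box[of a b c d] by (auto simp: p_def q_def split: split_indicator)
        ultimately show ?thesis by (simp only: box)
      qed
    qed
    then have "AE x in lebesgue. x \<in> box c d \<longrightarrow> G x = 0"
      unfolding AE_completion_iff
      using eq by eventually_elim (auto split: split_indicator_asm)
    \<comment> \<open>The cover of \<Omega> below consists of closed boxes, so the boundary has to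
      be discarded as a null set.\<close>
    moreover have "AE x in lebesgue. x \<notin> cbox c d - box c d"
      using negligible_frontier_interval[of c d]
      by (intro AE_not_in) (simp add: negligible_iff_null_sets)
    ultimately show ?thesis
      by eventually_elim blast
  qed
  obtain \<D> where \<D>: "countable \<D>" "\<D> \<subseteq> Pow \<Omega>" "\<And>X. X \<in> \<D> \<Longrightarrow> \<exists>a b. X = cbox a b" "\<Union>\<D> = \<Omega>"
    using open_countable_Union_open_cbox[OF \<open>open \<Omega>\<close>] by blast
  have "AE x in lebesgue. \<forall>X\<in>\<D>. x \<in> X \<longrightarrow> G x = 0"
  proof (subst AE_ball_countable[OF \<D>(1)], intro ballI)
    fix X assume "X \<in> \<D>"
    then show "AE x in lebesgue. x \<in> X \<longrightarrow> G x = 0"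
      using \<D>(2) \<D>(3)[of X] zero by blast
  qed
  then have "AE x in lebesgue. x \<in> \<Omega> \<longrightarrow> g x = 0"
    by eventually_elim (use \<D>(4) in \<open>auto simp: G_def indicator_def\<close>)
  then show ?thesis
    by (simp add: AE_restrict_space_iff[OF \<Omega>])
qed

section \<open>Gradients and linear combinations of test functions\<close>

lemma test_function_differentiable: "\<phi> \<in> test_functions \<Omega> \<Longrightarrow> \<phi> differentiable (at x)"
  unfolding test_functions_def using times_continuously_differentiable.simps(2) by blast

lemma continuous_gradient_test_function:
  assumes "\<phi> \<in> test_functions \<Omega>"
  shows "continuous_on UNIV (gradient \<phi>)"
proof (subst continuous_on_componentwise, intro ballI)
  fix i :: 'a assume "i \<in> Basis"
  moreover have "times_continuously_differentiable (Suc 0) \<phi>"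
    using assms by (simp only: test_functions_def mem_Collect_eq)
  ultimately show "continuous_on UNIV (\<lambda>x. gradient \<phi> x \<bullet> i)"
    by simp
qed

lemma gradient_linear:
  assumes "f differentiable (at x)" "g differentiable (at x)"
  shows "gradient (\<lambda>x. a * f x + b * g x) x = a *\<^sub>R gradient f x + b *\<^sub>R gradient g x"
proof (rule euclidean_eqI)
  fix i :: 'a assume i: "i \<in> Basis"
  have f: "(f has_derivative frechet_derivative f (at x)) (at x)"
    and g: "(g has_derivative frechet_derivative g (at x)) (at x)"
    using assms by (simp_all add: frechet_derivative_works)
  have "((\<lambda>x. a * f x + b * g x) has_derivative
      (\<lambda>h. a * frechet_derivative f (at x) h + b * frechet_derivative g (at x) h)) (at x)"
    by (intro derivative_intros f g)
  then show "gradient (\<lambda>x. a * f x + b * g x) x \<bullet> i = (a *\<^sub>R gradient f x + b *\<^sub>R gradient g x) \<bullet> i"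
    by (simp add: gradient_inner[OF _ i] gradient_inner[OF f i] gradient_inner[OF g i] inner_add_left)
qed

lemma test_functions_linear:
  assumes "\<phi> \<in> test_functions \<Omega>" "\<psi> \<in> test_functions \<Omega>"
  shows "(\<lambda>x. a * \<phi> x + b * \<psi> x) \<in> test_functions \<Omega>"
proof -
  have "closure {x. a * \<phi> x + b * \<psi> x \<noteq> 0} \<subseteq> closure ({x. \<phi> x \<noteq> 0} \<union> {x. \<psi> x \<noteq> 0})"
    by (intro closure_mono) auto
  then have sub: "closure {x. a * \<phi> x + b * \<psi> x \<noteq> 0} \<subseteq> closure {x. \<phi> x \<noteq> 0} \<union> closure {x. \<psi> x \<noteq> 0}"
    by simp
  moreover have "compact (closure {x. \<phi> x \<noteq> 0} \<union> closure {x. \<psi> x \<noteq> 0})"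
    using assms by (intro compact_Un) (auto simp: test_functions_def)
  ultimately have "compact (closure {x. a * \<phi> x + b * \<psi> x \<noteq> 0})"
    by (meson bounded_subset closed_closure compact_eq_bounded_closed)
  with sub show ?thesis
    using assms by (auto simp: test_functions_def intro!: times_continuously_differentiable_add
        times_continuously_differentiable_mult times_continuously_differentiable_const)
qed

section \<open>Weak gradients and divergences\<close>

lemma weak_gradient_works: "w \<in> H1 \<Omega> \<Longrightarrow> has_weak_gradient \<Omega> w (weak_gradient \<Omega> w)"
  unfolding H1_def weak_gradient_def
  by (auto intro: someI[where P = "has_weak_gradient \<Omega> w"])

lemma weak_divergence_works: "\<tau> \<in> Hdiv \<Omega> \<Longrightarrow> has_weak_divergence \<Omega> \<tau> (weak_divergence \<Omega> \<tau>)"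
  unfolding Hdiv_def weak_divergence_def
  by (auto intro: someI[where P = "has_weak_divergence \<Omega> \<tau>"])

lemma H10_H1: "w \<in> H10 \<Omega> \<Longrightarrow> w \<in> H1 \<Omega>"
  by (simp add: H10_def)

lemma H1_L2: "w \<in> H1 \<Omega> \<Longrightarrow> w \<in> L2 \<Omega>"
  by (simp add: H1_def)

lemmas H10_L2 = H1_L2[OF H10_H1]

lemma weak_gradient_L2: "w \<in> H1 \<Omega> \<Longrightarrow> weak_gradient \<Omega> w \<in> L2 \<Omega>"
  using weak_gradient_works unfolding has_weak_gradient_def by blast

lemmas H10_weak_gradient_L2 = weak_gradient_L2[OF H10_H1]

lemma Hdiv_L2: "\<tau> \<in> Hdiv \<Omega> \<Longrightarrow> \<tau> \<in> L2 \<Omega>"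
  by (simp add: Hdiv_def)

lemma weak_divergence_L2: "\<tau> \<in> Hdiv \<Omega> \<Longrightarrow> weak_divergence \<Omega> \<tau> \<in> L2 \<Omega>"
  using weak_divergence_works unfolding has_weak_divergence_def by blast

lemma H10_approx:
  assumes "w \<in> H10 \<Omega>" "\<epsilon> > 0"
  obtains \<phi> where "\<phi> \<in> test_functions \<Omega>" "L2norm \<Omega> (\<lambda>x. w x - \<phi> x) < \<epsilon>"
    "L2norm \<Omega> (\<lambda>x. weak_gradient \<Omega> w x - gradient \<phi> x) < \<epsilon>"
proof -
  from assms obtain \<phi> where "\<phi> \<in> test_functions \<Omega>"
    and less: "sqrt ((L2norm \<Omega> (\<lambda>x. w x - \<phi> x))\<^sup>2
      + (L2norm \<Omega> (\<lambda>x. weak_gradient \<Omega> w x - gradient \<phi> x))\<^sup>2) < \<epsilon>"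
    unfolding H10_def by blast
  then show ?thesis
    using that[of \<phi>] real_sqrt_sum_squares_ge1 real_sqrt_sum_squares_ge2 le_less_trans by blast
qed

text \<open>The triangle inequality yields separate, non-strict bounds for the function and its
  gradient; this turns them into the single strict bound in the definition of
  \<open>H10\<close>.\<close>

lemma H10_I:
  assumes "w \<in> H1 \<Omega>"
    and "\<And>\<epsilon>. \<epsilon> > 0 \<Longrightarrow> \<exists>\<phi>\<in>test_functions \<Omega>. L2norm \<Omega> (\<lambda>x. w x - \<phi> x) \<le> \<epsilon> \<and>
      L2norm \<Omega> (\<lambda>x. weak_gradient \<Omega> w x - gradient \<phi> x) \<le> \<epsilon>"
  shows "w \<in> H10 \<Omega>"
  unfolding H10_def
proof (intro CollectI conjI allI impI)
  fix \<epsilon> :: real assume "\<epsilon> > 0"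
  \<comment> \<open>Two terms of a third each leave room for strictness.\<close>
  then obtain \<phi> where \<phi>: "\<phi> \<in> test_functions \<Omega>" "L2norm \<Omega> (\<lambda>x. w x - \<phi> x) \<le> \<epsilon> / 3"
      "L2norm \<Omega> (\<lambda>x. weak_gradient \<Omega> w x - gradient \<phi> x) \<le> \<epsilon> / 3"
    using assms(2)[of "\<epsilon> / 3"] by auto
  have "sqrt ((L2norm \<Omega> (\<lambda>x. w x - \<phi> x))\<^sup>2 + (L2norm \<Omega> (\<lambda>x. weak_gradient \<Omega> w x - gradient \<phi> x))\<^sup>2)
      \<le> L2norm \<Omega> (\<lambda>x. w x - \<phi> x) + L2norm \<Omega> (\<lambda>x. weak_gradient \<Omega> w x - gradient \<phi> x)"
    by (rule sqrt_sum_squares_le_sum) auto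
  also have "\<dots> < \<epsilon>" using \<phi> \<open>\<epsilon> > 0\<close> by linarith
  finally show "\<exists>\<phi>\<in>test_functions \<Omega>. sqrt ((L2norm \<Omega> (\<lambda>x. w x - \<phi> x))\<^sup>2
      + (L2norm \<Omega> (\<lambda>x. weak_gradient \<Omega> w x - gradient \<phi> x))\<^sup>2) < \<epsilon>"
    using \<phi>(1) by blast
qed fact

section \<open>Weak derivatives on a bounded open set\<close>

locale bounded_open_set =
  fixes \<Omega> :: "'a::euclidean_space set"
  assumes open_domain: "open \<Omega>" and bounded_domain: "bounded \<Omega>"
begin

lemma const_L2: "(\<lambda>x. c) \<in> L2 \<Omega>"
proof -
  interpret finite_measure "lebesgue_on \<Omega>"
    using open_domain bounded_domain
    by (intro finite_measure_lebesgue_on bounded_set_imp_lmeasurable) auto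
  show ?thesis by (simp add: L2_def)
qed

lemma continuous_L2:
  fixes f :: "'a \<Rightarrow> 'b::euclidean_space"
  assumes "continuous_on UNIV f"
  shows "f \<in> L2 \<Omega>"
proof -
  have "compact (f ` closure \<Omega>)"
    using assms bounded_domain
    by (intro compact_continuous_image) (auto intro: continuous_on_subset)
  then obtain B where B: "\<And>x. x \<in> \<Omega> \<Longrightarrow> norm (f x) \<le> B"
    using closure_subset by (fastforce dest!: compact_imp_bounded simp: bounded_iff)
  show ?thesis
  proof (rule L2_bound[OF const_L2[of "1::real"]])
    show "AE x in lebesgue_on \<Omega>. norm (f x) \<le> B * norm (1::real)"
      using B by (intro AE_I2) (simp add: space_restrict_space)
  qed (rule continuous_borel_measurable_lebesgue_on[OF assms])
qed

lemma test_function_L2: "\<phi> \<in> test_functions \<Omega> \<Longrightarrow> \<phi> \<in> L2 \<Omega>"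
  by (intro continuous_L2 test_function_continuous)

lemma gradient_L2: "\<phi> \<in> test_functions \<Omega> \<Longrightarrow> gradient \<phi> \<in> L2 \<Omega>"
  by (intro continuous_L2 continuous_gradient_test_function)

text \<open>The fundamental lemma is scalar, so it is applied to each component of G - H, and the
  finitely many exceptional null sets are joined.\<close>

lemma weak_gradient_unique:
  assumes "has_weak_gradient \<Omega> w G" "has_weak_gradient \<Omega> w H"
  shows "AE x in lebesgue_on \<Omega>. G x = H x"
proof -
  have G: "G \<in> L2 \<Omega>" and H: "H \<in> L2 \<Omega>"
    using assms by (auto simp: has_weak_gradient_def)
  have D: "(\<lambda>x. G x - H x) \<in> L2 \<Omega>" by (rule L2_diff[OF G H])
  have "AE x in lebesgue_on \<Omega>. (G x - H x) \<bullet> i = 0" for i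
  proof (rule AE_zero_if_test_integrals_zero[OF open_domain])
    show "integrable (lebesgue_on \<Omega>) (\<lambda>x. (G x - H x) \<bullet> i)"
      \<comment> \<open>The component is a pairing with the constant field i, which is square
        integrable because \<Omega> is bounded.\<close>
      using integrable_L2_inner(2)[OF D const_L2] .
    fix \<phi> assume \<phi>: "\<phi> \<in> test_functions \<Omega>"
    note int = integrable_L2_scaleR[OF test_function_L2[OF \<phi>]]
    have "(LINT x|lebesgue_on \<Omega>. \<phi> x * ((G x - H x) \<bullet> i))
        = (LINT x|lebesgue_on \<Omega>. (\<phi> x *\<^sub>R (G x - H x)) \<bullet> i)"
      by simp
    also have "\<dots> = (LINT x|lebesgue_on \<Omega>. \<phi> x *\<^sub>R (G x - H x)) \<bullet> i"
      by (rule integral_inner_left) (use int[OF D] in simp)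
    also have "(LINT x|lebesgue_on \<Omega>. \<phi> x *\<^sub>R (G x - H x)) = 0"
    proof -
      have "(LINT x|lebesgue_on \<Omega>. \<phi> x *\<^sub>R G x) = (LINT x|lebesgue_on \<Omega>. \<phi> x *\<^sub>R H x)"
        using assms \<phi> by (force simp: has_weak_gradient_def)
      then show ?thesis
        by (simp add: scaleR_diff_right int G H)
    qed
    finally show "(LINT x|lebesgue_on \<Omega>. \<phi> x * ((G x - H x) \<bullet> i)) = 0" by simp
  qed
  then have "AE x in lebesgue_on \<Omega>. \<forall>i\<in>Basis. (G x - H x) \<bullet> i = 0"
    by (subst AE_ball_countable) (auto simp: countable_finite)
  then show ?thesis
    by eventually_elim (auto intro: euclidean_eqI simp: inner_diff_left)
qed

lemma has_weak_gradient_linear: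
  assumes "w \<in> L2 \<Omega>" "z \<in> L2 \<Omega>" "has_weak_gradient \<Omega> w G" "has_weak_gradient \<Omega> z H"
  shows "has_weak_gradient \<Omega> (\<lambda>x. a * w x + b * z x) (\<lambda>x. a *\<^sub>R G x + b *\<^sub>R H x)"
  unfolding has_weak_gradient_def
proof (intro conjI ballI)
  have G: "G \<in> L2 \<Omega>" and H: "H \<in> L2 \<Omega>"
    using assms by (auto simp: has_weak_gradient_def)
  show "(\<lambda>x. a *\<^sub>R G x + b *\<^sub>R H x) \<in> L2 \<Omega>" by (rule L2_linear[OF G H])
  fix \<phi> assume \<phi>: "\<phi> \<in> test_functions \<Omega>"
  have int: "integrable (lebesgue_on \<Omega>) (\<lambda>x. f x *\<^sub>R gradient \<phi> x)" if "f \<in> L2 \<Omega>" for f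
    by (rule integrable_L2_scaleR[OF that gradient_L2[OF \<phi>]])
  have int': "integrable (lebesgue_on \<Omega>) (\<lambda>x. \<phi> x *\<^sub>R F x)" if "F \<in> L2 \<Omega>" for F :: "'a \<Rightarrow> 'a"
    by (rule integrable_L2_scaleR[OF test_function_L2[OF \<phi>] that])
  have "(LINT x|lebesgue_on \<Omega>. (a * w x + b * z x) *\<^sub>R gradient \<phi> x)
      = (LINT x|lebesgue_on \<Omega>. a *\<^sub>R (w x *\<^sub>R gradient \<phi> x) + b *\<^sub>R (z x *\<^sub>R gradient \<phi> x))"
    by (simp add: scaleR_add_left)
  also have "\<dots> = a *\<^sub>R (LINT x|lebesgue_on \<Omega>. w x *\<^sub>R gradient \<phi> x)
      + b *\<^sub>R (LINT x|lebesgue_on \<Omega>. z x *\<^sub>R gradient \<phi> x)"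
    using assms(1,2) by (subst Bochner_Integration.integral_add) (auto intro: int simp del: scaleR_scaleR)
  also have "\<dots> = - (a *\<^sub>R (LINT x|lebesgue_on \<Omega>. \<phi> x *\<^sub>R G x) + b *\<^sub>R (LINT x|lebesgue_on \<Omega>. \<phi> x *\<^sub>R H x))"
    using assms(3,4) \<phi> by (simp add: has_weak_gradient_def)
  also have "a *\<^sub>R (LINT x|lebesgue_on \<Omega>. \<phi> x *\<^sub>R G x) + b *\<^sub>R (LINT x|lebesgue_on \<Omega>. \<phi> x *\<^sub>R H x)
      = (LINT x|lebesgue_on \<Omega>. a *\<^sub>R (\<phi> x *\<^sub>R G x) + b *\<^sub>R (\<phi> x *\<^sub>R H x))"
    using int'[OF G] int'[OF H] by (simp del: scaleR_scaleR)
  also have "\<dots> = (LINT x|lebesgue_on \<Omega>. \<phi> x *\<^sub>R (a *\<^sub>R G x + b *\<^sub>R H x))"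
    by (simp add: scaleR_add_right mult.commute)
  finally show "(LINT x|lebesgue_on \<Omega>. (a * w x + b * z x) *\<^sub>R gradient \<phi> x)
      = - (LINT x|lebesgue_on \<Omega>. \<phi> x *\<^sub>R (a *\<^sub>R G x + b *\<^sub>R H x))" .
qed

text \<open>The gradient of the combination is a choice independent of the two others; uniqueness
  alone ties it to their combination.\<close>

lemma
  assumes w: "w \<in> H1 \<Omega>" and z: "z \<in> H1 \<Omega>"
  shows H1_linear: "(\<lambda>x. a * w x + b * z x) \<in> H1 \<Omega>"
    and weak_gradient_linear: "AE x in lebesgue_on \<Omega>. weak_gradient \<Omega> (\<lambda>x. a * w x + b * z x) x
      = a *\<^sub>R weak_gradient \<Omega> w x + b *\<^sub>R weak_gradient \<Omega> z x"
proof -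
  note lin = has_weak_gradient_linear[OF H1_L2[OF w] H1_L2[OF z] weak_gradient_works[OF w]
      weak_gradient_works[OF z], of a b]
  show H1: "(\<lambda>x. a * w x + b * z x) \<in> H1 \<Omega>"
    using L2_linear_real[OF H1_L2[OF w] H1_L2[OF z]] lin by (auto simp: H1_def)
  show "AE x in lebesgue_on \<Omega>. weak_gradient \<Omega> (\<lambda>x. a * w x + b * z x) x
      = a *\<^sub>R weak_gradient \<Omega> w x + b *\<^sub>R weak_gradient \<Omega> z x"
    by (rule weak_gradient_unique[OF weak_gradient_works[OF H1] lin])
qed

lemma H10_linear:
  assumes w: "w \<in> H10 \<Omega>" and z: "z \<in> H10 \<Omega>"
  shows "(\<lambda>x. a * w x + b * z x) \<in> H10 \<Omega>"
proof (rule H10_I)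
  let ?y = "\<lambda>x. a * w x + b * z x"
  show H1: "?y \<in> H1 \<Omega>"
    using H1_linear H10_H1 w z by blast
  fix \<epsilon> :: real assume "\<epsilon> > 0"
  \<comment> \<open>The summand 1 keeps the denominator positive when a and b are both 0.\<close>
  define \<delta> where "\<delta> = \<epsilon> / (\<bar>a\<bar> + \<bar>b\<bar> + 1)"
  have \<delta>: "\<delta> > 0" "(\<bar>a\<bar> + \<bar>b\<bar>) * \<delta> \<le> \<epsilon>"
    using \<open>\<epsilon> > 0\<close> by (auto simp: \<delta>_def field_simps add_pos_nonneg)
  obtain \<phi> where \<phi>: "\<phi> \<in> test_functions \<Omega>" "L2norm \<Omega> (\<lambda>x. w x - \<phi> x) < \<delta>"
    "L2norm \<Omega> (\<lambda>x. weak_gradient \<Omega> w x - gradient \<phi> x) < \<delta>"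
    by (rule H10_approx[OF w \<delta>(1)])
  obtain \<psi> where \<psi>: "\<psi> \<in> test_functions \<Omega>" "L2norm \<Omega> (\<lambda>x. z x - \<psi> x) < \<delta>"
    "L2norm \<Omega> (\<lambda>x. weak_gradient \<Omega> z x - gradient \<psi> x) < \<delta>"
    by (rule H10_approx[OF z \<delta>(1)])
  let ?\<theta> = "\<lambda>x. a * \<phi> x + b * \<psi> x"
  have \<theta>: "?\<theta> \<in> test_functions \<Omega>" by (rule test_functions_linear[OF \<phi>(1) \<psi>(1)])
  have small: "\<bar>a\<bar> * p + \<bar>b\<bar> * q \<le> \<epsilon>" if "p < \<delta>" "q < \<delta>" for p q
  proof -
    have "\<bar>a\<bar> * p + \<bar>b\<bar> * q \<le> \<bar>a\<bar> * \<delta> + \<bar>b\<bar> * \<delta>"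
      using that by (intro add_mono mult_left_mono) auto
    then show ?thesis using \<delta>(2) by (simp add: distrib_right)
  qed
  have "L2norm \<Omega> (\<lambda>x. ?y x - ?\<theta> x) = L2norm \<Omega> (\<lambda>x. a *\<^sub>R (w x - \<phi> x) + b *\<^sub>R (z x - \<psi> x))"
    by (simp add: algebra_simps)
  also have "\<dots> \<le> \<bar>a\<bar> * L2norm \<Omega> (\<lambda>x. w x - \<phi> x) + \<bar>b\<bar> * L2norm \<Omega> (\<lambda>x. z x - \<psi> x)"
    by (intro L2norm_linear_le L2_diff H10_L2 w z test_function_L2 \<phi> \<psi>)
  also have "\<dots> \<le> \<epsilon>" by (rule small[OF \<phi>(2) \<psi>(2)])
  finally have 1: "L2norm \<Omega> (\<lambda>x. ?y x - ?\<theta> x) \<le> \<epsilon>" .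
  have diffs: "(\<lambda>x. weak_gradient \<Omega> w x - gradient \<phi> x) \<in> L2 \<Omega>"
    "(\<lambda>x. weak_gradient \<Omega> z x - gradient \<psi> x) \<in> L2 \<Omega>"
    by (intro L2_diff H10_weak_gradient_L2 w z gradient_L2 \<phi> \<psi>)+
  have "L2norm \<Omega> (\<lambda>x. weak_gradient \<Omega> ?y x - gradient ?\<theta> x) =
      L2norm \<Omega> (\<lambda>x. a *\<^sub>R (weak_gradient \<Omega> w x - gradient \<phi> x) + b *\<^sub>R (weak_gradient \<Omega> z x - gradient \<psi> x))"
  proof (rule L2norm_AE_cong)
    show "(\<lambda>x. weak_gradient \<Omega> ?y x - gradient ?\<theta> x) \<in> L2 \<Omega>"
      by (intro L2_diff weak_gradient_L2 H1 gradient_L2 \<theta>)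
    show "AE x in lebesgue_on \<Omega>. weak_gradient \<Omega> ?y x - gradient ?\<theta> x =
      a *\<^sub>R (weak_gradient \<Omega> w x - gradient \<phi> x) + b *\<^sub>R (weak_gradient \<Omega> z x - gradient \<psi> x)"
      using weak_gradient_linear[OF H10_H1[OF w] H10_H1[OF z], of a b]
      by eventually_elim
        (simp add: gradient_linear test_function_differentiable[OF \<phi>(1)]
          test_function_differentiable[OF \<psi>(1)] algebra_simps)
  qed (rule L2_linear[OF diffs])
  also have "\<dots> \<le> \<epsilon>"
    using L2norm_linear_le[OF diffs, of a b] small[OF \<phi>(3) \<psi>(3)] by linarith
  finally show "\<exists>\<theta>\<in>test_functions \<Omega>. L2norm \<Omega> (\<lambda>x. ?y x - \<theta> x) \<le> \<epsilon> \<and>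
      L2norm \<Omega> (\<lambda>x. weak_gradient \<Omega> ?y x - gradient \<theta> x) \<le> \<epsilon>"
    by (intro bexI[OF _ \<theta>] conjI 1)
qed

lemma H10_diff: "w \<in> H10 \<Omega> \<Longrightarrow> z \<in> H10 \<Omega> \<Longrightarrow> (\<lambda>x. w x - z x) \<in> H10 \<Omega>"
  using H10_linear[of w z 1 "-1"] by simp

lemma weak_gradient_diff:
  assumes "w \<in> H10 \<Omega>" "z \<in> H10 \<Omega>"
  shows "AE x in lebesgue_on \<Omega>. weak_gradient \<Omega> (\<lambda>x. w x - z x) x
    = weak_gradient \<Omega> w x - weak_gradient \<Omega> z x"
  using weak_gradient_linear[OF assms[THEN H10_H1], of 1 "-1"] by simp

text \<open>For test functions this is the definition of the weak divergence. The defect of the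
  identity is continuous in the norm in which \<open>H10\<close> is the closure of the test
  functions, so it is smaller than any positive number.\<close>

lemma integration_by_parts:
  assumes w: "w \<in> H10 \<Omega>" and \<tau>: "\<tau> \<in> Hdiv \<Omega>"
  shows "L2inner \<Omega> \<tau> (weak_gradient \<Omega> w) = - L2inner \<Omega> (weak_divergence \<Omega> \<tau>) w"
proof -
  let ?G = "weak_gradient \<Omega> w" and ?h = "weak_divergence \<Omega> \<tau>"
  let ?C = "L2norm \<Omega> \<tau> + L2norm \<Omega> ?h"
  note \<tau>L = Hdiv_L2[OF \<tau>] and hL = weak_divergence_L2[OF \<tau>]
  have bound: "\<bar>L2inner \<Omega> \<tau> ?G + L2inner \<Omega> ?h w\<bar> \<le> ?C * \<epsilon>" if \<epsilon>: "\<epsilon> > 0" for \<epsilon>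
  proof -
    obtain \<phi> where \<phi>: "\<phi> \<in> test_functions \<Omega>" "L2norm \<Omega> (\<lambda>x. w x - \<phi> x) < \<epsilon>"
      "L2norm \<Omega> (\<lambda>x. ?G x - gradient \<phi> x) < \<epsilon>"
      by (rule H10_approx[OF w \<epsilon>])
    note L = H10_L2[OF w] H10_weak_gradient_L2[OF w] test_function_L2[OF \<phi>(1)] gradient_L2[OF \<phi>(1)]
    have "L2inner \<Omega> \<tau> (gradient \<phi>) = - L2inner \<Omega> ?h \<phi>"
      using weak_divergence_works[OF \<tau>] \<phi>(1) by (simp add: has_weak_divergence_def L2inner_def)
    then have "L2inner \<Omega> \<tau> ?G + L2inner \<Omega> ?h w
        = L2inner \<Omega> \<tau> (\<lambda>x. ?G x - gradient \<phi> x) + L2inner \<Omega> ?h (\<lambda>x. w x - \<phi> x)"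
      by (simp add: L2inner_diff_right L \<tau>L hL)
    also have "\<bar>\<dots>\<bar> \<le> L2norm \<Omega> \<tau> * L2norm \<Omega> (\<lambda>x. ?G x - gradient \<phi> x)
        + L2norm \<Omega> ?h * L2norm \<Omega> (\<lambda>x. w x - \<phi> x)"
      by (intro order_trans[OF abs_triangle_ineq] add_mono L2_Cauchy_Schwarz L2_diff L \<tau>L hL)
    also have "\<dots> \<le> L2norm \<Omega> \<tau> * \<epsilon> + L2norm \<Omega> ?h * \<epsilon>"
      using \<phi> by (intro add_mono mult_left_mono) auto
    finally show ?thesis by (simp add: distrib_right)
  qed
  have "\<bar>L2inner \<Omega> \<tau> ?G + L2inner \<Omega> ?h w\<bar> \<le> 0 + e" if "e > 0" for e
  proof -
    \<comment> \<open>The constant in \<open>bound\<close> may be 0, hence the shift in the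
      denominator.\<close>
    have "c * (e / (c + 1)) \<le> e" if "c \<ge> 0" for c
      using that \<open>e > 0\<close> by (simp add: field_simps)
    then have "?C * (e / (?C + 1)) \<le> e" by simp
    moreover have "e / (?C + 1) > 0"
      using that by (intro divide_pos_pos add_nonneg_pos) auto
    ultimately show ?thesis
      using bound[of "e / (?C + 1)"] by linarith
  qed
  then have "\<bar>L2inner \<Omega> \<tau> ?G + L2inner \<Omega> ?h w\<bar> \<le> 0"
    by (rule field_le_epsilon)
  then show ?thesis by simp
qed

end

section \<open>The state equation\<close>

locale elliptic_problem = bounded_open_set \<Omega> for \<Omega> :: "'a::euclidean_space set" +
  fixes \<nu> :: "'a \<Rightarrow> real" and \<nu>\<^sub>m \<nu>\<^sub>M C\<^sub>F :: real
  assumes coefficient_measurable: "\<nu> \<in> borel_measurable (lebesgue_on \<Omega>)"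
    and lower_pos: "0 < \<nu>\<^sub>m"
    and coefficient_bounds: "\<And>x. x \<in> \<Omega> \<Longrightarrow> \<nu>\<^sub>m \<le> \<nu> x \<and> \<nu> x \<le> \<nu>\<^sub>M"
    and friedrichs: "friedrichs_constant \<Omega> C\<^sub>F"
begin

abbreviation grad :: "('a \<Rightarrow> real) \<Rightarrow> 'a \<Rightarrow> 'a" where
  "grad \<equiv> weak_gradient \<Omega>"

lemma friedrichs_pos: "0 < C\<^sub>F"
  using friedrichs by (simp add: friedrichs_constant_def)

lemma friedrichs_le: "w \<in> H10 \<Omega> \<Longrightarrow> L2norm \<Omega> w \<le> C\<^sub>F * L2norm \<Omega> (grad w)"
  using friedrichs by (simp add: friedrichs_constant_def)

lemma flux_L2:
  assumes G: "G \<in> L2 \<Omega>"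
  shows "(\<lambda>x. \<nu> x *\<^sub>R G x) \<in> L2 \<Omega>"
proof (rule L2_bound[OF G])
  note [measurable] = coefficient_measurable L2_measurable[OF G]
  show "(\<lambda>x. \<nu> x *\<^sub>R G x) \<in> borel_measurable (lebesgue_on \<Omega>)" by measurable
  have "\<bar>\<nu> x\<bar> \<le> \<nu>\<^sub>M" if "x \<in> \<Omega>" for x
    using coefficient_bounds[OF that] lower_pos by linarith
  then show "AE x in lebesgue_on \<Omega>. norm (\<nu> x *\<^sub>R G x) \<le> \<nu>\<^sub>M * norm (G x)"
    by (intro AE_I2) (auto simp: space_restrict_space intro: mult_right_mono)
qed

lemma coercive:
  assumes G: "G \<in> L2 \<Omega>"
  shows "\<nu>\<^sub>m * (L2norm \<Omega> G)\<^sup>2 \<le> L2inner \<Omega> (\<lambda>x. \<nu> x *\<^sub>R G x) G"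
proof -
  have "\<nu>\<^sub>m * (L2norm \<Omega> G)\<^sup>2 = (LINT x|lebesgue_on \<Omega>. \<nu>\<^sub>m * (G x \<bullet> G x))"
    by (simp add: L2norm_square L2inner_def)
  also have "\<dots> \<le> (LINT x|lebesgue_on \<Omega>. (\<nu> x *\<^sub>R G x) \<bullet> G x)"
  proof (rule integral_mono)
    show "integrable (lebesgue_on \<Omega>) (\<lambda>x. \<nu>\<^sub>m * (G x \<bullet> G x))"
      using integrable_L2_inner(2)[OF G G] by simp
    show "integrable (lebesgue_on \<Omega>) (\<lambda>x. (\<nu> x *\<^sub>R G x) \<bullet> G x)"
      by (rule integrable_L2_inner(2)[OF flux_L2[OF G] G])
    show "\<nu>\<^sub>m * (G x \<bullet> G x) \<le> (\<nu> x *\<^sub>R G x) \<bullet> G x" if "x \<in> space (lebesgue_on \<Omega>)" for x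
      using that coefficient_bounds[of x] by (auto simp: space_restrict_space intro: mult_right_mono)
  qed
  finally show ?thesis by (simp add: L2inner_def)
qed

text \<open>Symmetry of the bilinear form, owed to \<nu> being scalar. It lets the state equation
  tested with \<zeta> be read as a pairing of the flux of \<zeta> with the gradient of the state
  error.\<close>

lemma flux_inner_commute:
  "L2inner \<Omega> (\<lambda>x. \<nu> x *\<^sub>R G x) H = L2inner \<Omega> (\<lambda>x. \<nu> x *\<^sub>R H x) G"
  by (simp add: L2inner_def inner_commute)

lemma norm_grad_diff:
  assumes "w \<in> H10 \<Omega>" "z \<in> H10 \<Omega>"
  shows "L2norm \<Omega> (grad (\<lambda>x. w x - z x)) = L2norm \<Omega> (\<lambda>x. grad w x - grad z x)"
  by (intro L2norm_AE_cong weak_gradient_diff assms L2_diff H10_weak_gradient_L2 H10_diff)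

lemma inner_grad_diff:
  assumes "w \<in> H10 \<Omega>" "z \<in> H10 \<Omega>" "q \<in> L2 \<Omega>"
  shows "L2inner \<Omega> q (grad (\<lambda>x. w x - z x)) = L2inner \<Omega> q (grad w) - L2inner \<Omega> q (grad z)"
proof -
  note L = assms(3) assms(1,2)[THEN H10_weak_gradient_L2]
  have "L2inner \<Omega> q (grad (\<lambda>x. w x - z x)) = L2inner \<Omega> q (\<lambda>x. grad w x - grad z x)"
    by (intro L2inner_AE_cong weak_gradient_diff assms L2_diff L H10_weak_gradient_L2 H10_diff) simp
  then show ?thesis by (simp add: L2inner_diff_right L)
qed

section \<open>Residuals and energy estimates\<close>

text \<open>Friedrichs' inequality trades the norm of e for that of its gradient. This is the source
  of every combination of a norm weighted by \<open>C\<^sub>F\<close> with an unweighted flux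
  norm.\<close>

lemma residual_bound:
  assumes e: "e \<in> H10 \<Omega>" and r: "r \<in> L2 \<Omega>" and q: "q \<in> L2 \<Omega>"
  shows "\<bar>L2inner \<Omega> r e + L2inner \<Omega> q (grad e)\<bar>
    \<le> (C\<^sub>F * L2norm \<Omega> r + L2norm \<Omega> q) * L2norm \<Omega> (grad e)"
proof -
  have "\<bar>L2inner \<Omega> r e + L2inner \<Omega> q (grad e)\<bar>
      \<le> L2norm \<Omega> r * L2norm \<Omega> e + L2norm \<Omega> q * L2norm \<Omega> (grad e)"
    by (intro order_trans[OF abs_triangle_ineq] add_mono L2_Cauchy_Schwarz H10_L2
        H10_weak_gradient_L2 e r q)
  also have "\<dots> \<le> L2norm \<Omega> r * (C\<^sub>F * L2norm \<Omega> (grad e)) + L2norm \<Omega> q * L2norm \<Omega> (grad e)"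
    by (intro add_mono mult_left_mono friedrichs_le e) auto
  finally show ?thesis by (simp add: algebra_simps)
qed

text \<open>The equation is already tested with e itself: coercivity bounds it from below by the
  square of the gradient norm, the residual bound from above by its first power, and one factor
  cancels.\<close>

lemma energy_bound:
  assumes e: "e \<in> H10 \<Omega>" and r: "r \<in> L2 \<Omega>" and q: "q \<in> L2 \<Omega>"
    and eq: "L2inner \<Omega> (\<lambda>x. \<nu> x *\<^sub>R grad e x) (grad e) = L2inner \<Omega> r e + L2inner \<Omega> q (grad e)"
  shows "\<nu>\<^sub>m * L2norm \<Omega> (grad e) \<le> C\<^sub>F * L2norm \<Omega> r + L2norm \<Omega> q"
proof (cases "L2norm \<Omega> (grad e) = 0")
  case True
  then show ?thesis using friedrichs_pos by simp
next
  case False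
  then have pos: "L2norm \<Omega> (grad e) > 0" by (simp add: less_le)
  have "\<nu>\<^sub>m * L2norm \<Omega> (grad e) * L2norm \<Omega> (grad e)
      \<le> (C\<^sub>F * L2norm \<Omega> r + L2norm \<Omega> q) * L2norm \<Omega> (grad e)"
    using coercive[OF H10_weak_gradient_L2[OF e]] residual_bound[OF e r q] eq
    by (simp add: power2_eq_square mult.assoc)
  with pos show ?thesis by simp
qed

lemma weak_solution_inner:
  assumes "weak_solution \<Omega> \<nu> F y" "w \<in> H10 \<Omega>"
  shows "L2inner \<Omega> (\<lambda>x. \<nu> x *\<^sub>R grad y x) (grad w) = L2inner \<Omega> F w"
  using assms by (simp add: weak_solution_def L2inner_def)

lemma flux_grad_diff:
  assumes "w \<in> H10 \<Omega>" "z \<in> H10 \<Omega>" "p \<in> H10 \<Omega>"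
  shows "L2inner \<Omega> (\<lambda>x. \<nu> x *\<^sub>R grad (\<lambda>x. w x - z x) x) (grad p)
    = L2inner \<Omega> (\<lambda>x. \<nu> x *\<^sub>R grad w x) (grad p) - L2inner \<Omega> (\<lambda>x. \<nu> x *\<^sub>R grad z x) (grad p)"
  by (simp add: flux_inner_commute[of "grad _" "grad p"]
      inner_grad_diff[OF assms(1,2) flux_L2[OF H10_weak_gradient_L2[OF assms(3)]]])

text \<open>The two contributions of \<tau> cancel on integrating by parts, so any field may be
  inserted to make the residual of \<eta> accessible to norms. It serves the state equation with
  \<tau> and, with \<rho>, \<zeta> and source \<eta> - y_d in these places, the adjoint
  equation.\<close>

lemma flux_divergence_identity:
  assumes \<tau>: "\<tau> \<in> Hdiv \<Omega>" and \<eta>: "\<eta> \<in> H10 \<Omega>" and w: "w \<in> H10 \<Omega>" and F: "F \<in> L2 \<Omega>"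
  shows "L2inner \<Omega> (\<lambda>x. F x + weak_divergence \<Omega> \<tau> x) w
      + L2inner \<Omega> (\<lambda>x. \<tau> x - \<nu> x *\<^sub>R grad \<eta> x) (grad w)
    = L2inner \<Omega> F w - L2inner \<Omega> (\<lambda>x. \<nu> x *\<^sub>R grad \<eta> x) (grad w)"
  using \<tau> \<eta> w F
  by (simp add: L2inner_add_left L2inner_diff_left weak_divergence_L2 Hdiv_L2 H10_L2
      H10_weak_gradient_L2 flux_L2 integration_by_parts)

text \<open>The difference y - \<eta> solves an equation whose right-hand side is the residual of
  \<eta>; inserting \<tau> leaves a bound free of the unknown y.\<close>

lemma state_error_bound:
  assumes y: "weak_solution \<Omega> \<nu> F y" and F: "F \<in> L2 \<Omega>" and \<eta>: "\<eta> \<in> H10 \<Omega>" and \<tau>: "\<tau> \<in> Hdiv \<Omega>"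
  shows "\<nu>\<^sub>m * L2norm \<Omega> (grad (\<lambda>x. y x - \<eta> x))
    \<le> C\<^sub>F * L2norm \<Omega> (\<lambda>x. F x + weak_divergence \<Omega> \<tau> x)
      + L2norm \<Omega> (\<lambda>x. \<tau> x - \<nu> x *\<^sub>R grad \<eta> x)"
proof -
  have yH: "y \<in> H10 \<Omega>" using y by (simp add: weak_solution_def)
  note e = H10_diff[OF yH \<eta>]
  show ?thesis
  proof (rule energy_bound[OF e])
    show "(\<lambda>x. F x + weak_divergence \<Omega> \<tau> x) \<in> L2 \<Omega>"
      by (intro L2_add F weak_divergence_L2 \<tau>)
    show "(\<lambda>x. \<tau> x - \<nu> x *\<^sub>R grad \<eta> x) \<in> L2 \<Omega>"
      by (intro L2_diff Hdiv_L2 \<tau> flux_L2 H10_weak_gradient_L2 \<eta>)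
  qed (simp add: flux_divergence_identity[OF \<tau> \<eta> e F] flux_grad_diff[OF yH \<eta> e]
      weak_solution_inner[OF y e])
qed

text \<open>The energy bound with vanishing flux part, since both states belong to the same
  operator.\<close>

lemma state_stability:
  assumes y: "weak_solution \<Omega> \<nu> F y" and z: "weak_solution \<Omega> \<nu> H z"
    and F: "F \<in> L2 \<Omega>" and H: "H \<in> L2 \<Omega>"
  shows "\<nu>\<^sub>m * L2norm \<Omega> (grad (\<lambda>x. y x - z x)) \<le> C\<^sub>F * L2norm \<Omega> (\<lambda>x. F x - H x)"
proof -
  have yH: "y \<in> H10 \<Omega>" and zH: "z \<in> H10 \<Omega>" using y z by (simp_all add: weak_solution_def)
  note e = H10_diff[OF yH zH]
  have zero: "L2inner \<Omega> (\<lambda>x. 0::'a) g = 0" for g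
    by (simp add: L2inner_def)
  have "\<nu>\<^sub>m * L2norm \<Omega> (grad (\<lambda>x. y x - z x))
      \<le> C\<^sub>F * L2norm \<Omega> (\<lambda>x. F x - H x) + L2norm \<Omega> (\<lambda>x. 0::'a)"
    by (rule energy_bound[OF e L2_diff[OF F H] const_L2])
      (simp add: flux_grad_diff[OF yH zH e] weak_solution_inner[OF y e] weak_solution_inner[OF z e]
        L2inner_diff_left[OF F H H10_L2[OF e]] zero)
  then show ?thesis by (simp add: L2norm_def)
qed

lemma weak_solution_linear:
  assumes y: "weak_solution \<Omega> \<nu> F y" and z: "weak_solution \<Omega> \<nu> H z"
    and F: "F \<in> L2 \<Omega>" and H: "H \<in> L2 \<Omega>"
  shows "weak_solution \<Omega> \<nu> (\<lambda>x. a * F x + b * H x) (\<lambda>x. a * y x + b * z x)"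
proof -
  have yH: "y \<in> H10 \<Omega>" and zH: "z \<in> H10 \<Omega>" using y z by (simp_all add: weak_solution_def)
  note lin = H10_linear[OF yH zH, of a b]
  note G = yH[THEN H10_weak_gradient_L2] zH[THEN H10_weak_gradient_L2]
  show ?thesis
    unfolding weak_solution_def
  proof (intro conjI ballI lin)
    fix w assume w: "w \<in> H10 \<Omega>"
    note Gw = H10_weak_gradient_L2[OF w]
    have "(LINT x|lebesgue_on \<Omega>. \<nu> x * (grad (\<lambda>x. a * y x + b * z x) x \<bullet> grad w x))
        = L2inner \<Omega> (\<lambda>x. \<nu> x *\<^sub>R grad w x) (grad (\<lambda>x. a * y x + b * z x))"
      by (simp add: L2inner_def inner_commute)
    also have "\<dots> = L2inner \<Omega> (\<lambda>x. \<nu> x *\<^sub>R grad w x) (\<lambda>x. a *\<^sub>R grad y x + b *\<^sub>R grad z x)"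
      by (intro L2inner_AE_cong weak_gradient_linear H10_H1 yH zH flux_L2 Gw L2_linear G
          H10_weak_gradient_L2 lin) simp
    also have "\<dots> = a * L2inner \<Omega> (\<lambda>x. \<nu> x *\<^sub>R grad y x) (grad w)
        + b * L2inner \<Omega> (\<lambda>x. \<nu> x *\<^sub>R grad z x) (grad w)"
      by (simp only: L2inner_add_right[OF L2_scaleR[OF G(1)] L2_scaleR[OF G(2)] flux_L2[OF Gw]]
          L2inner_scaleR_right flux_inner_commute[of "grad w"])
    also have "\<dots> = L2inner \<Omega> (\<lambda>x. a *\<^sub>R F x + b *\<^sub>R H x) w"
      by (simp only: weak_solution_inner[OF y w] weak_solution_inner[OF z w]
          L2inner_add_left[OF L2_scaleR[OF F] L2_scaleR[OF H] H10_L2[OF w]] L2inner_scaleR_left)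
    finally show "(LINT x|lebesgue_on \<Omega>. \<nu> x * (grad (\<lambda>x. a * y x + b * z x) x \<bullet> grad w x))
        = (LINT x|lebesgue_on \<Omega>. (a * F x + b * H x) * w x)"
      by (simp add: L2inner_def)
  qed
qed

lemma weak_solution_unique:
  assumes "weak_solution \<Omega> \<nu> F y" "weak_solution \<Omega> \<nu> F z" "F \<in> L2 \<Omega>"
  shows "L2norm \<Omega> (\<lambda>x. y x - z x) = 0"
proof -
  have e: "(\<lambda>x. y x - z x) \<in> H10 \<Omega>"
    using assms by (intro H10_diff) (simp_all add: weak_solution_def)
  have "\<nu>\<^sub>m * L2norm \<Omega> (grad (\<lambda>x. y x - z x)) \<le> 0"
    using state_stability[OF assms(1,2,3,3)] by (simp add: L2norm_def)
  then have "L2norm \<Omega> (grad (\<lambda>x. y x - z x)) \<le> 0"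
    using lower_pos by (simp add: mult_le_0_iff)
  then have "C\<^sub>F * L2norm \<Omega> (grad (\<lambda>x. y x - z x)) \<le> 0"
    using friedrichs_pos by (simp add: mult_le_0_iff)
  with friedrichs_le[OF e] show ?thesis
    by (intro antisym order_trans[OF friedrichs_le[OF e]]) auto
qed

end

section \<open>The control problem\<close>

text \<open>Completeness of Lebesgue measure. A control prescribed only almost everywhere has no
  measurability of its own and inherits it from the formula.\<close>

lemma borel_measurable_lebesgue_on_AE:
  fixes f :: "'a::euclidean_space \<Rightarrow> 'b::euclidean_space"
  assumes \<Omega>: "\<Omega> \<in> sets lebesgue" and f: "f \<in> borel_measurable (lebesgue_on \<Omega>)"
    and eq: "AE x in lebesgue_on \<Omega>. f x = g x"
  shows "g \<in> borel_measurable (lebesgue_on \<Omega>)"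
proof -
  have \<Omega>': "\<Omega> \<inter> space lebesgue \<in> sets lebesgue" using \<Omega> by simp
  have "AE x in lebesgue. indicator \<Omega> x *\<^sub>R f x = indicator \<Omega> x *\<^sub>R g x"
    using eq unfolding AE_restrict_space_iff[OF \<Omega>'] by eventually_elim (auto simp: indicator_def)
  with f show ?thesis
    unfolding borel_measurable_restrict_space_iff[OF \<Omega>'] by (rule borel_measurable_AE)
qed

lemma young_square:
  fixes a b t :: real
  assumes "t > 0"
  shows "(a + b)\<^sup>2 \<le> (1 + t) * a\<^sup>2 + (1 + 1 / t) * b\<^sup>2"
proof -
  have "0 \<le> (t * a - b)\<^sup>2 / t" using assms by simp
  also have "(t * a - b)\<^sup>2 / t = (1 + t) * a\<^sup>2 + (1 + 1 / t) * b\<^sup>2 - (a + b)\<^sup>2"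
    using assms by (simp add: field_simps power2_eq_square)
  finally show ?thesis by simp
qed

text \<open>Clipping is the projection of m = c - z / lam onto [a, b], and v - m makes a nonnegative
  product with u - v for every u in the interval. Multiplication by lam turns v - m into the
  expression in the claim.\<close>

lemma clip_variational_inequality:
  fixes lam u a b c z :: real
  assumes "lam > 0" "a \<le> u" "u \<le> b" and v: "v = min b (max a (c - 1 / lam * z))"
  shows "0 \<le> (lam * (v - c) + z) * (u - v)"
proof -
  define m where "m = c - 1 / lam * z"
  have "lam * (v - c) + z = lam * (v - m)"
    using \<open>lam > 0\<close> by (simp add: m_def field_simps)
  moreover have "0 \<le> (v - m) * (u - v)"
    using assms unfolding v m_def[symmetric]
    by (auto simp: min_def max_def zero_le_mult_iff)
  ultimately show ?thesis
    using \<open>lam > 0\<close> by (simp add: mult.assoc)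
qed

locale control_problem = elliptic_problem \<Omega> \<nu> \<nu>\<^sub>m \<nu>\<^sub>M C\<^sub>F
  for \<Omega> :: "'a::euclidean_space set" and \<nu> \<nu>\<^sub>m \<nu>\<^sub>M C\<^sub>F +
  fixes lam :: real and f y\<^sub>d u\<^sub>d u\<^sub>a u\<^sub>b :: "'a \<Rightarrow> real" and S :: "('a \<Rightarrow> real) \<Rightarrow> 'a \<Rightarrow> real"
  assumes lam_pos: "0 < lam"
    and data_L2: "f \<in> L2 \<Omega>" "y\<^sub>d \<in> L2 \<Omega>" "u\<^sub>d \<in> L2 \<Omega>"
    and control_bounds_L2: "u\<^sub>a \<in> L2 \<Omega>" "u\<^sub>b \<in> L2 \<Omega>"
    and control_bounds_le: "AE x in lebesgue_on \<Omega>. u\<^sub>a x \<le> u\<^sub>b x"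
    and solution: "solution_operator \<Omega> \<nu> f S"
begin

abbreviation "U \<equiv> admissible_controls \<Omega> u\<^sub>a u\<^sub>b"
abbreviation "J v \<equiv> cost \<Omega> lam y\<^sub>d u\<^sub>d (S v) v"

lemma admissible_L2: "v \<in> U \<Longrightarrow> v \<in> L2 \<Omega>"
  by (simp add: admissible_controls_def)

lemma state_solves: "v \<in> L2 \<Omega> \<Longrightarrow> weak_solution \<Omega> \<nu> (\<lambda>x. f x + v x) (S v)"
  using solution by (simp add: solution_operator_def)

lemma state_H10: "v \<in> L2 \<Omega> \<Longrightarrow> S v \<in> H10 \<Omega>"
  using state_solves by (simp add: weak_solution_def)

lemma rhs_L2: "v \<in> L2 \<Omega> \<Longrightarrow> (\<lambda>x. f x + v x) \<in> L2 \<Omega>"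
  by (intro L2_add data_L2)

lemma admissible_convex:
  assumes "u \<in> U" "v \<in> U" "0 \<le> t" "t \<le> 1"
  shows "(\<lambda>x. (1 - t) * u x + t * v x) \<in> U"
proof -
  have "AE x in lebesgue_on \<Omega>. u\<^sub>a x \<le> (1 - t) * u x + t * v x \<and> (1 - t) * u x + t * v x \<le> u\<^sub>b x"
  proof -
    have "AE x in lebesgue_on \<Omega>. u\<^sub>a x \<le> u x \<and> u x \<le> u\<^sub>b x" "AE x in lebesgue_on \<Omega>. u\<^sub>a x \<le> v x \<and> v x \<le> u\<^sub>b x"
      using assms by (auto simp: admissible_controls_def)
    then show ?thesis
    proof eventually_elim
      case (elim x)
      have "(1 - t) * u\<^sub>a x + t * u\<^sub>a x \<le> (1 - t) * u x + t * v x"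
        "(1 - t) * u x + t * v x \<le> (1 - t) * u\<^sub>b x + t * u\<^sub>b x"
        using elim assms by (intro add_mono mult_left_mono; simp)+
      then show ?case by (simp add: left_diff_distrib)
    qed
  qed
  then show ?thesis
    using assms by (simp add: admissible_controls_def L2_linear_real)
qed

lemma clip_admissible:
  assumes \<zeta>: "\<zeta> \<in> L2 \<Omega>"
    and v: "AE x in lebesgue_on \<Omega>. v x = min (u\<^sub>b x) (max (u\<^sub>a x) (u\<^sub>d x - 1 / lam * \<zeta> x))"
  shows "v \<in> U"
proof -
  let ?c = "\<lambda>x. min (u\<^sub>b x) (max (u\<^sub>a x) (u\<^sub>d x - 1 / lam * \<zeta> x))"
  note [measurable] = L2_measurable[OF \<zeta>] L2_measurable[OF data_L2(3)]
    L2_measurable[OF control_bounds_L2(1)] L2_measurable[OF control_bounds_L2(2)]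
  have bounds: "AE x in lebesgue_on \<Omega>. u\<^sub>a x \<le> v x \<and> v x \<le> u\<^sub>b x"
    using v control_bounds_le by eventually_elim auto
  have [measurable]: "v \<in> borel_measurable (lebesgue_on \<Omega>)"
  proof (rule borel_measurable_lebesgue_on_AE)
    show "\<Omega> \<in> sets lebesgue" using open_domain by simp
    show "?c \<in> borel_measurable (lebesgue_on \<Omega>)" by measurable
    show "AE x in lebesgue_on \<Omega>. ?c x = v x"
      using v by eventually_elim simp
  qed
  \<comment> \<open>Square integrability comes from the control bounds alone: whatever lies between
    them is dominated by this sum.\<close>
  have "(\<lambda>x. \<bar>u\<^sub>a x\<bar> + \<bar>u\<^sub>b x\<bar>) \<in> L2 \<Omega>"
  proof (rule L2_add)
    show "(\<lambda>x. \<bar>u\<^sub>a x\<bar>) \<in> L2 \<Omega>" "(\<lambda>x. \<bar>u\<^sub>b x\<bar>) \<in> L2 \<Omega>"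
      by (rule L2_bound[where C = 1, OF control_bounds_L2(1)]; simp)
        (rule L2_bound[where C = 1, OF control_bounds_L2(2)]; simp)
  qed
  then have "v \<in> L2 \<Omega>"
  proof (rule L2_bound)
    show "AE x in lebesgue_on \<Omega>. norm (v x) \<le> 1 * norm (\<bar>u\<^sub>a x\<bar> + \<bar>u\<^sub>b x\<bar>)"
      using bounds by eventually_elim auto
  qed measurable
  with bounds show ?thesis by (simp add: admissible_controls_def)
qed

section \<open>The cost along a segment of controls\<close>

text \<open>The weights add up to 1, so f is reproduced exactly and the combination of the two
  states solves the equation for the combined control. Uniqueness then identifies it with whatever
  representative \<open>S\<close> returns.\<close>

lemma state_affine:
  assumes u: "u \<in> L2 \<Omega>" and v: "v \<in> L2 \<Omega>"
  shows "AE x in lebesgue_on \<Omega>. S (\<lambda>x. (1 - t) * u x + t * v x) x = (1 - t) * S u x + t * S v x"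
proof -
  let ?w = "\<lambda>x. (1 - t) * u x + t * v x"
  have w: "?w \<in> L2 \<Omega>" by (rule L2_linear_real[OF u v])
  have "(\<lambda>x. (1 - t) * (f x + u x) + t * (f x + v x)) = (\<lambda>x. f x + ?w x)"
    by (auto simp: algebra_simps)
  with weak_solution_linear[OF state_solves[OF u] state_solves[OF v] rhs_L2[OF u] rhs_L2[OF v], of "1 - t" t]
  have sol: "weak_solution \<Omega> \<nu> (\<lambda>x. f x + ?w x) (\<lambda>x. (1 - t) * S u x + t * S v x)"
    by simp
  have "L2norm \<Omega> (\<lambda>x. S ?w x - ((1 - t) * S u x + t * S v x)) = 0"
    by (rule weak_solution_unique[OF state_solves[OF w] sol rhs_L2[OF w]])
  moreover have "(\<lambda>x. S ?w x - ((1 - t) * S u x + t * S v x)) \<in> L2 \<Omega>"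
    by (intro L2_diff L2_linear_real H10_L2 state_H10 w u v)
  ultimately have "AE x in lebesgue_on \<Omega>. S ?w x - ((1 - t) * S u x + t * S v x) = 0"
    by (intro L2norm_eq_0_AE)
  then show ?thesis by eventually_elim simp
qed

text \<open>The error measure is the purely quadratic part of the cost: subtracting y_d or u_d from
  both endpoints leaves their difference unchanged, so the convexity defects of the two terms add up
  to exactly \<open>error_sq\<close>.\<close>

lemma cost_convex_combination:
  assumes u: "u \<in> L2 \<Omega>" and v: "v \<in> L2 \<Omega>"
  shows "J (\<lambda>x. (1 - t) * u x + t * v x)
    = (1 - t) * J u + t * J v - t * (1 - t) * error_sq \<Omega> lam S u v"
proof -
  let ?w = "\<lambda>x. (1 - t) * u x + t * v x"
  have w: "?w \<in> L2 \<Omega>" by (rule L2_linear_real[OF u v])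
  note y = H10_L2[OF state_H10[OF u]] H10_L2[OF state_H10[OF v]]
  have comb: "(L2norm \<Omega> (\<lambda>x. ((1 - t) * p x + t * q x) - c x))\<^sup>2
      = (1 - t) * (L2norm \<Omega> (\<lambda>x. p x - c x))\<^sup>2 + t * (L2norm \<Omega> (\<lambda>x. q x - c x))\<^sup>2
        - t * (1 - t) * (L2norm \<Omega> (\<lambda>x. p x - q x))\<^sup>2"
    if "p \<in> L2 \<Omega>" "q \<in> L2 \<Omega>" "c \<in> L2 \<Omega>" for p q c :: "'a \<Rightarrow> real"
    using L2norm_convex_combination[OF L2_diff[OF that(1,3)] L2_diff[OF that(2,3)], of t]
    by (simp add: algebra_simps)
  have state: "L2norm \<Omega> (\<lambda>x. S ?w x - y\<^sub>d x) = L2norm \<Omega> (\<lambda>x. ((1 - t) * S u x + t * S v x) - y\<^sub>d x)"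
  proof (rule L2norm_AE_cong)
    show "AE x in lebesgue_on \<Omega>. S ?w x - y\<^sub>d x = (1 - t) * S u x + t * S v x - y\<^sub>d x"
      using state_affine[OF u v, of t] by eventually_elim simp
  qed (intro L2_diff L2_linear_real H10_L2 state_H10 u v w data_L2)+
  show ?thesis
    unfolding cost_def error_sq_def state comb[OF y data_L2(2)] comb[OF u v data_L2(3)]
    by (simp add: field_simps)
qed

text \<open>Replaces the first-order optimality condition. Comparing u with the point at parameter t
  gives the claim with factor 1 - t after division by t; the limit t to 0+ removes the
  factor.\<close>

lemma error_sq_le_cost_diff:
  assumes opt: "optimal_control \<Omega> lam y\<^sub>d u\<^sub>d u\<^sub>a u\<^sub>b S u" and v: "v \<in> U"
  shows "error_sq \<Omega> lam S u v \<le> J v - J u"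
proof -
  let ?E = "error_sq \<Omega> lam S u v"
  have u: "u \<in> U" and min: "\<And>w. w \<in> U \<Longrightarrow> J u \<le> J w"
    using opt by (auto simp: optimal_control_def is_arg_min_linorder)
  have "(1 - t) * ?E \<le> J v - J u" if t: "0 < t" "t < 1" for t
  proof -
    have "J u \<le> (1 - t) * J u + t * J v - t * (1 - t) * ?E"
      using min[OF admissible_convex[OF u v, of t]] t
      by (simp add: cost_convex_combination admissible_L2 u v)
    then have "t * ((1 - t) * ?E) \<le> t * (J v - J u)"
      by (simp add: algebra_simps)
    with t show ?thesis by simp
  qed
  then have "\<forall>\<^sub>F t in at_right 0. (1 - t) * ?E \<le> J v - J u"
    by (auto simp: eventually_at_right_field intro!: exI[of _ 1])
  moreover have "((\<lambda>t. (1 - t) * ?E) \<longlongrightarrow> (1 - 0) * ?E) (at_right 0)"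
    by (intro tendsto_intros)
  ultimately have "(1 - 0) * ?E \<le> J v - J u"
    by (intro tendsto_upperbound) auto
  then show ?thesis by simp
qed

section \<open>Upper and lower bounds for the cost\<close>

text \<open>Young's inequality enters twice: \<alpha> separates the misfit of \<eta> from the state
  error, and \<beta> separates the flux residual q from the equilibrium residual r. The state error
  carries \<open>C\<^sub>F / \<nu>\<^sub>m\<close>, from Friedrichs and coercivity, and r one more
  \<open>C\<^sub>F\<close>; squaring produces the weights with second and fourth powers.\<close>

lemma cost_le_majorant:
  assumes v: "v \<in> L2 \<Omega>" and \<eta>: "\<eta> \<in> H10 \<Omega>" and \<tau>: "\<tau> \<in> Hdiv \<Omega>" and pos: "\<alpha> > 0" "\<beta> > 0"
  shows "J v \<le> cost_majorant \<Omega> \<nu> \<nu>\<^sub>m C\<^sub>F lam f y\<^sub>d u\<^sub>d \<alpha> \<beta> \<eta> \<tau> v"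
proof -
  define r where "r = L2norm \<Omega> (\<lambda>x. f x + v x + weak_divergence \<Omega> \<tau> x)"
  define q where "q = L2norm \<Omega> (\<lambda>x. \<tau> x - \<nu> x *\<^sub>R grad \<eta> x)"
  define a where "a = L2norm \<Omega> (\<lambda>x. \<eta> x - y\<^sub>d x)"
  define e where "e = L2norm \<Omega> (\<lambda>x. S v x - \<eta> x)"
  note eH = H10_diff[OF state_H10[OF v] \<eta>]
  have "L2norm \<Omega> (\<lambda>x. S v x - y\<^sub>d x) \<le> a + e"
    using L2norm_triangle[OF L2_diff[OF H10_L2[OF \<eta>] data_L2(2)] H10_L2[OF eH]]
    by (simp add: a_def e_def)
  then have "(L2norm \<Omega> (\<lambda>x. S v x - y\<^sub>d x))\<^sup>2 \<le> (a + e)\<^sup>2"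
    by (intro power_mono) auto
  also have "\<dots> \<le> (1 + \<alpha>) * a\<^sup>2 + (1 + 1 / \<alpha>) * e\<^sup>2"
    by (rule young_square[OF pos(1)])
  also have "\<dots> \<le> (1 + \<alpha>) * a\<^sup>2 + (1 + 1 / \<alpha>) * ((C\<^sub>F / \<nu>\<^sub>m)\<^sup>2 * ((1 + \<beta>) * q\<^sup>2 + (1 + 1 / \<beta>) * (C\<^sub>F * r)\<^sup>2))"
  proof -
    have "\<nu>\<^sub>m * L2norm \<Omega> (grad (\<lambda>x. S v x - \<eta> x)) \<le> q + C\<^sub>F * r"
      using state_error_bound[OF state_solves[OF v] rhs_L2[OF v] \<eta> \<tau>]
      by (simp add: q_def r_def)
    then have "L2norm \<Omega> (grad (\<lambda>x. S v x - \<eta> x)) \<le> (q + C\<^sub>F * r) / \<nu>\<^sub>m"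
      using lower_pos by (simp add: field_simps)
    then have "C\<^sub>F * L2norm \<Omega> (grad (\<lambda>x. S v x - \<eta> x)) \<le> C\<^sub>F * ((q + C\<^sub>F * r) / \<nu>\<^sub>m)"
      using friedrichs_pos by (intro mult_left_mono) auto
    with friedrichs_le[OF eH] have "e \<le> C\<^sub>F / \<nu>\<^sub>m * (q + C\<^sub>F * r)"
      by (simp add: e_def)
    then have "e\<^sup>2 \<le> (C\<^sub>F / \<nu>\<^sub>m * (q + C\<^sub>F * r))\<^sup>2"
      by (intro power_mono) (auto simp: e_def)
    also have "\<dots> = (C\<^sub>F / \<nu>\<^sub>m)\<^sup>2 * (q + C\<^sub>F * r)\<^sup>2"
      by (rule power_mult_distrib)
    also have "\<dots> \<le> (C\<^sub>F / \<nu>\<^sub>m)\<^sup>2 * ((1 + \<beta>) * q\<^sup>2 + (1 + 1 / \<beta>) * (C\<^sub>F * r)\<^sup>2)"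
      by (intro mult_left_mono young_square pos) simp
    finally show ?thesis
      using pos by (intro add_left_mono mult_left_mono) auto
  qed
  finally have "1 / 2 * (L2norm \<Omega> (\<lambda>x. S v x - y\<^sub>d x))\<^sup>2 \<le> 1 / 2 * ((1 + \<alpha>) * a\<^sup>2
      + (1 + 1 / \<alpha>) * ((C\<^sub>F / \<nu>\<^sub>m)\<^sup>2 * ((1 + \<beta>) * q\<^sup>2 + (1 + 1 / \<beta>) * (C\<^sub>F * r)\<^sup>2)))"
    by simp
  also have "\<dots> = (1 + \<alpha>) / 2 * a\<^sup>2
      + (1 + \<alpha>) * (1 + \<beta>) * C\<^sub>F ^ 2 / (2 * \<alpha> * \<nu>\<^sub>m ^ 2) * q\<^sup>2
      + (1 + \<alpha>) * (1 + \<beta>) * C\<^sub>F ^ 4 / (2 * \<alpha> * \<beta> * \<nu>\<^sub>m ^ 2) * r\<^sup>2"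
  proof -
    have "1 + 1 / \<alpha> = (1 + \<alpha>) / \<alpha>" "1 + 1 / \<beta> = (1 + \<beta>) / \<beta>"
      using pos by (simp_all add: field_simps)
    moreover have "C\<^sub>F ^ 4 = C\<^sub>F\<^sup>2 * C\<^sub>F\<^sup>2"
      by (simp add: power_add[symmetric])
    ultimately show ?thesis
      using pos lower_pos by (simp add: power_mult_distrib power_divide) (simp add: field_simps)
  qed
  finally show ?thesis
    by (simp add: cost_def cost_majorant_def a_def q_def r_def)
qed

text \<open>All integrals and norms are abbreviated by real numbers, so that the last step is linear
  arithmetic. There, the term lam b in the expanded cost is bounded below by -c, and c is replaced
  by n + m - k; what remains beyond k - m is a - n plus the quadratic control term.\<close>

lemma minorant_le_cost:
  assumes u: "u \<in> U" and v: "v \<in> U" and \<zeta>: "\<zeta> \<in> H10 \<Omega>"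
    and clip: "AE x in lebesgue_on \<Omega>. v x = min (u\<^sub>b x) (max (u\<^sub>a x) (u\<^sub>d x - 1 / lam * \<zeta> x))"
    and \<eta>: "\<eta> \<in> H10 \<Omega>" and \<tau>: "\<tau> \<in> Hdiv \<Omega>" and \<rho>: "\<rho> \<in> Hdiv \<Omega>"
  shows "cost_minorant \<Omega> \<nu> \<nu>\<^sub>m C\<^sub>F lam f y\<^sub>d u\<^sub>d \<eta> \<zeta> \<tau> \<rho> v \<le> J u"
proof -
  note uL = admissible_L2[OF u] and vL = admissible_L2[OF v]
  note yu = state_H10[OF uL] and yv = state_H10[OF vL]
  let ?e = "\<lambda>x. S u x - \<eta> x"
  note e = H10_diff[OF yu \<eta>]
  define A where "A = L2norm \<Omega> (\<lambda>x. \<eta> x - y\<^sub>d x + weak_divergence \<Omega> \<rho> x)"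
  define B where "B = L2norm \<Omega> (\<lambda>x. \<rho> x - \<nu> x *\<^sub>R grad \<zeta> x)"
  define r where "r = L2norm \<Omega> (\<lambda>x. f x + v x + weak_divergence \<Omega> \<tau> x)"
  define q where "q = L2norm \<Omega> (\<lambda>x. \<tau> x - \<nu> x *\<^sub>R grad \<eta> x)"
  define s where "s = L2norm \<Omega> (\<lambda>x. u x - v x)"
  \<comment> \<open>Of these pairings a, b, c and n contain the unknown u, whereas k and m are
    computable.\<close>
  define a where "a = L2inner \<Omega> (\<lambda>x. \<eta> x - y\<^sub>d x) ?e"
  define b where "b = L2inner \<Omega> (\<lambda>x. v x - u\<^sub>d x) (\<lambda>x. u x - v x)"
  define c where "c = L2inner \<Omega> \<zeta> (\<lambda>x. u x - v x)"
  define k where "k = L2inner \<Omega> (\<lambda>x. f x + v x) \<zeta>"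
  define m where "m = L2inner \<Omega> (\<lambda>x. \<nu> x *\<^sub>R grad \<eta> x) (grad \<zeta>)"
  define n where "n = L2inner \<Omega> (\<lambda>x. \<nu> x *\<^sub>R grad \<zeta> x) (grad ?e)"
  define K where "K = C\<^sub>F * A + B"
  have \<eta>d: "(\<lambda>x. \<eta> x - y\<^sub>d x) \<in> L2 \<Omega>" and vd: "(\<lambda>x. v x - u\<^sub>d x) \<in> L2 \<Omega>"
    and uv: "(\<lambda>x. u x - v x) \<in> L2 \<Omega>"
    by (intro L2_diff H10_L2 \<eta> data_L2 uL vL)+

  \<comment> \<open>Expansion about \<eta>. The square of the state error is dropped here, while its
    counterpart s^2 for the controls is kept below to absorb a linear term.\<close>
  have state_term: "(L2norm \<Omega> (\<lambda>x. S u x - y\<^sub>d x))\<^sup>2 \<ge> (L2norm \<Omega> (\<lambda>x. \<eta> x - y\<^sub>d x))\<^sup>2 + 2 * a"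
    using L2norm_add_square[OF \<eta>d H10_L2[OF e]] by (simp add: a_def)
  have control_term: "(L2norm \<Omega> (\<lambda>x. u x - u\<^sub>d x))\<^sup>2 = (L2norm \<Omega> (\<lambda>x. v x - u\<^sub>d x))\<^sup>2 + 2 * b + s\<^sup>2"
    using L2norm_add_square[OF vd uv] by (simp add: b_def s_def)
  have variational: "0 \<le> lam * b + c"
  proof -
    have "0 \<le> L2inner \<Omega> (\<lambda>x. lam * (v x - u\<^sub>d x) + \<zeta> x) (\<lambda>x. u x - v x)"
      unfolding L2inner_def
    proof (rule integral_nonneg_AE)
      have "AE x in lebesgue_on \<Omega>. u\<^sub>a x \<le> u x \<and> u x \<le> u\<^sub>b x"
        using u by (simp add: admissible_controls_def)
      then show "AE x in lebesgue_on \<Omega>. 0 \<le> (lam * (v x - u\<^sub>d x) + \<zeta> x) \<bullet> (u x - v x)"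
        using clip by eventually_elim (auto simp: inner_real_def intro!: clip_variational_inequality[OF lam_pos])
    qed
    also have "\<dots> = lam * b + c"
      using L2inner_add_left[OF L2_scaleR[OF vd, of lam] H10_L2[OF \<zeta>] uv]
        L2inner_scaleR_left[of \<Omega> lam "\<lambda>x. v x - u\<^sub>d x" "\<lambda>x. u x - v x"]
      by (simp add: b_def c_def)
    finally show ?thesis .
  qed
  \<comment> \<open>Writing f + u as (f + v) + (u - v) isolates the unknown control in c, the same
    pairing that occurs in the variational inequality.\<close>
  have state_eq: "n + m = k + c"
  proof -
    have "n = L2inner \<Omega> (\<lambda>x. \<nu> x *\<^sub>R grad (S u) x) (grad \<zeta>) - m"
      unfolding n_def m_def flux_inner_commute[of "grad \<zeta>"]
      by (rule flux_grad_diff[OF yu \<eta> \<zeta>])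
    also have "L2inner \<Omega> (\<lambda>x. \<nu> x *\<^sub>R grad (S u) x) (grad \<zeta>) = L2inner \<Omega> (\<lambda>x. (f x + v x) + (u x - v x)) \<zeta>"
      using weak_solution_inner[OF state_solves[OF uL] \<zeta>] by simp
    also have "\<dots> = k + c"
      unfolding L2inner_add_left[OF rhs_L2[OF vL] uv H10_L2[OF \<zeta>]]
      by (simp add: k_def c_def L2inner_commute[of _ _ \<zeta>])
    finally show ?thesis by simp
  qed
  have primal: "L2inner \<Omega> (\<lambda>x. f x + v x + weak_divergence \<Omega> \<tau> x) \<zeta>
      + L2inner \<Omega> (\<lambda>x. \<tau> x - \<nu> x *\<^sub>R grad \<eta> x) (grad \<zeta>) = k - m"
    using flux_divergence_identity[OF \<tau> \<eta> \<zeta> rhs_L2[OF vL]] by (simp add: k_def m_def)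
  \<comment> \<open>Here \<zeta> acts as an approximate adjoint state with flux \<rho> and source
    \<eta> - y_d; a - n is its residual at the state error.\<close>
  have dual: "\<bar>a - n\<bar> \<le> K * L2norm \<Omega> (grad ?e)"
    using residual_bound[OF e L2_add[OF \<eta>d weak_divergence_L2[OF \<rho>]]
        L2_diff[OF Hdiv_L2[OF \<rho>] flux_L2[OF H10_weak_gradient_L2[OF \<zeta>]]]]
      flux_divergence_identity[OF \<rho> \<zeta> e \<eta>d]
    by (simp add: a_def n_def K_def A_def B_def)
  \<comment> \<open>The first summand compares the states of u and v, the other two the state of v
    with \<eta>.\<close>
  have "L2norm \<Omega> (grad ?e) \<le> (C\<^sub>F * s + (C\<^sub>F * r + q)) / \<nu>\<^sub>m"
  proof -
    note G = yu[THEN H10_weak_gradient_L2] yv[THEN H10_weak_gradient_L2] \<eta>[THEN H10_weak_gradient_L2]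
    have "L2norm \<Omega> (grad ?e) = L2norm \<Omega> (\<lambda>x. (grad (S u) x - grad (S v) x) + (grad (S v) x - grad \<eta> x))"
      using norm_grad_diff[OF yu \<eta>] by simp
    also have "\<dots> \<le> L2norm \<Omega> (grad (\<lambda>x. S u x - S v x)) + L2norm \<Omega> (grad (\<lambda>x. S v x - \<eta> x))"
      unfolding norm_grad_diff[OF yu yv] norm_grad_diff[OF yv \<eta>]
      by (intro L2norm_triangle L2_diff G)
    finally have "\<nu>\<^sub>m * L2norm \<Omega> (grad ?e) \<le> \<nu>\<^sub>m * \<dots>"
      using lower_pos by simp
    also have "\<dots> \<le> C\<^sub>F * s + (C\<^sub>F * r + q)"
      using state_stability[OF state_solves[OF uL] state_solves[OF vL] rhs_L2[OF uL] rhs_L2[OF vL]]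
        state_error_bound[OF state_solves[OF vL] rhs_L2[OF vL] \<eta> \<tau>]
      by (simp add: distrib_left s_def r_def q_def)
    finally show ?thesis
      using lower_pos by (simp add: field_simps)
  qed
  moreover have "K \<ge> 0"
    using friedrichs_pos by (simp add: K_def A_def B_def)
  ultimately have "a - n \<ge> - (K * ((C\<^sub>F * s + (C\<^sub>F * r + q)) / \<nu>\<^sub>m))"
    using dual mult_left_mono[of "L2norm \<Omega> (grad ?e)" "(C\<^sub>F * s + (C\<^sub>F * r + q)) / \<nu>\<^sub>m" K] by linarith
  moreover have "lam / 2 * s\<^sup>2 - K * ((C\<^sub>F * s + (C\<^sub>F * r + q)) / \<nu>\<^sub>m)
      \<ge> - (1 / \<nu>\<^sub>m * K * (C\<^sub>F\<^sup>2 / (lam * \<nu>\<^sub>m) * K + C\<^sub>F * r + q))"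
  proof -
    \<comment> \<open>The coefficient of s in the linear term. Completing the square costs h^2 / (2
      lam); with another such summand the cost is h^2 / lam, which is exactly the K-quadratic term
      of the minorant.\<close>
    define h where "h = K * C\<^sub>F / \<nu>\<^sub>m"
    have "0 \<le> (lam * s - h)\<^sup>2 / (2 * lam) + h\<^sup>2 / (2 * lam)"
      using lam_pos by simp
    also have "\<dots> = lam / 2 * s\<^sup>2 - h * s + h\<^sup>2 / lam"
      using lam_pos by (simp add: field_simps power2_eq_square)
    also have "\<dots> = lam / 2 * s\<^sup>2 - K * ((C\<^sub>F * s + (C\<^sub>F * r + q)) / \<nu>\<^sub>m)
        + 1 / \<nu>\<^sub>m * K * (C\<^sub>F\<^sup>2 / (lam * \<nu>\<^sub>m) * K + C\<^sub>F * r + q)"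
      using lam_pos lower_pos by (simp add: h_def field_simps power2_eq_square)
    finally show ?thesis by simp
  qed
  moreover have "C\<^sub>F\<^sup>2 / (lam * \<nu>\<^sub>m) * K = C\<^sub>F ^ 3 / (lam * \<nu>\<^sub>m) * A + C\<^sub>F\<^sup>2 / (lam * \<nu>\<^sub>m) * B"
    by (simp add: K_def algebra_simps power2_eq_square power3_eq_cube add_divide_distrib)
  ultimately have key: "a - n + lam / 2 * s\<^sup>2 \<ge> - (1 / \<nu>\<^sub>m * K *
      (C\<^sub>F ^ 3 / (lam * \<nu>\<^sub>m) * A + C\<^sub>F\<^sup>2 / (lam * \<nu>\<^sub>m) * B + C\<^sub>F * r + q))"
    by simp
  have "cost_minorant \<Omega> \<nu> \<nu>\<^sub>m C\<^sub>F lam f y\<^sub>d u\<^sub>d \<eta> \<zeta> \<tau> \<rho> v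
      = 1 / 2 * (L2norm \<Omega> (\<lambda>x. \<eta> x - y\<^sub>d x))\<^sup>2 + lam / 2 * (L2norm \<Omega> (\<lambda>x. v x - u\<^sub>d x))\<^sup>2 + (k - m)
        - 1 / \<nu>\<^sub>m * K * (C\<^sub>F ^ 3 / (lam * \<nu>\<^sub>m) * A + C\<^sub>F\<^sup>2 / (lam * \<nu>\<^sub>m) * B + C\<^sub>F * r + q)"
    unfolding primal[symmetric]
    by (simp add: cost_minorant_def L2inner_def K_def A_def B_def r_def q_def)
  moreover have "J u = 1 / 2 * (L2norm \<Omega> (\<lambda>x. S u x - y\<^sub>d x))\<^sup>2
      + lam / 2 * (L2norm \<Omega> (\<lambda>x. v x - u\<^sub>d x))\<^sup>2 + lam * b + lam / 2 * s\<^sup>2"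
    by (simp add: cost_def control_term algebra_simps)
  ultimately show ?thesis
    using key state_term variational state_eq by linarith
qed

end

theorem theorem4:
  fixes \<Omega> :: "'a::euclidean_space set"
    and \<nu> y\<^sub>d u\<^sub>d f u\<^sub>a u\<^sub>b u v\<^sub>\<zeta> \<eta> \<zeta> :: "'a \<Rightarrow> real"
    and \<tau> \<rho> :: "'a \<Rightarrow> 'a"
    and S :: "('a \<Rightarrow> real) \<Rightarrow> 'a \<Rightarrow> real"
    and lam \<nu>\<^sub>m \<nu>\<^sub>M C\<^sub>F \<alpha> \<beta> :: real
  assumes dim: "DIM('a) \<in> {1, 2, 3}"
    and domain: "bounded_lipschitz_domain \<Omega>"
    and data: "y\<^sub>d \<in> L2 \<Omega>" "u\<^sub>d \<in> L2 \<Omega>" "f \<in> L2 \<Omega>"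
    and lam: "lam > 0"
    and nu_measurable: "\<nu> \<in> borel_measurable (lebesgue_on \<Omega>)"
    and nu_bounds: "0 < \<nu>\<^sub>m" "\<And>x. x \<in> \<Omega> \<Longrightarrow> \<nu>\<^sub>m \<le> \<nu> x \<and> \<nu> x \<le> \<nu>\<^sub>M"
    and C_F: "friedrichs_constant \<Omega> C\<^sub>F"
    and state: "solution_operator \<Omega> \<nu> f S"
    and control_bounds: "u\<^sub>a \<in> L2 \<Omega>" "u\<^sub>b \<in> L2 \<Omega>" "AE x in lebesgue_on \<Omega>. u\<^sub>a x \<le> u\<^sub>b x"
    and u: "optimal_control \<Omega> lam y\<^sub>d u\<^sub>d u\<^sub>a u\<^sub>b S u"
    and zeta: "\<zeta> \<in> H10 \<Omega>"
    and v_zeta: "AE x in lebesgue_on \<Omega>. v\<^sub>\<zeta> x = min (u\<^sub>b x) (max (u\<^sub>a x) (u\<^sub>d x - 1 / lam * \<zeta> x))"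
    and eta: "\<eta> \<in> H10 \<Omega>"
    and tau: "\<tau> \<in> Hdiv \<Omega>"
    and rho: "\<rho> \<in> Hdiv \<Omega>"
    and alpha: "\<alpha> > 0"
    and beta: "\<beta> > 0"
  shows "v\<^sub>\<zeta> \<in> admissible_controls \<Omega> u\<^sub>a u\<^sub>b \<and>
    error_sq \<Omega> lam S u v\<^sub>\<zeta> \<le> error_majorant \<Omega> \<nu> \<nu>\<^sub>m C\<^sub>F lam f y\<^sub>d u\<^sub>d \<alpha> \<beta> \<eta> \<zeta> \<tau> \<rho> v\<^sub>\<zeta> \<and>
    error_majorant \<Omega> \<nu> \<nu>\<^sub>m C\<^sub>F lam f y\<^sub>d u\<^sub>d \<alpha> \<beta> \<eta> \<zeta> \<tau> \<rho> v\<^sub>\<zeta> =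
      \<alpha> / 2 * (L2norm \<Omega> (\<lambda>x. \<eta> x - y\<^sub>d x))\<^sup>2
      + (1 + \<alpha>) * (1 + \<beta>) * C\<^sub>F^2 / (2 * \<alpha> * \<nu>\<^sub>m^2)
          * (L2norm \<Omega> (\<lambda>x. \<tau> x - \<nu> x *\<^sub>R weak_gradient \<Omega> \<eta> x))\<^sup>2
      + (1 + \<alpha>) * (1 + \<beta>) * C\<^sub>F^4 / (2 * \<alpha> * \<beta> * \<nu>\<^sub>m^2)
          * (L2norm \<Omega> (\<lambda>x. f x + v\<^sub>\<zeta> x + weak_divergence \<Omega> \<tau> x))\<^sup>2
      - (LINT x|lebesgue_on \<Omega>. (f x + v\<^sub>\<zeta> x + weak_divergence \<Omega> \<tau> x) * \<zeta> x)
      - (LINT x|lebesgue_on \<Omega>. (\<tau> x - \<nu> x *\<^sub>R weak_gradient \<Omega> \<eta> x) \<bullet> weak_gradient \<Omega> \<zeta> x)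
      + 1 / \<nu>\<^sub>m
        * (C\<^sub>F * L2norm \<Omega> (\<lambda>x. \<eta> x - y\<^sub>d x + weak_divergence \<Omega> \<rho> x)
           + L2norm \<Omega> (\<lambda>x. \<rho> x - \<nu> x *\<^sub>R weak_gradient \<Omega> \<zeta> x))
        * (C\<^sub>F^3 / (lam * \<nu>\<^sub>m) * L2norm \<Omega> (\<lambda>x. \<eta> x - y\<^sub>d x + weak_divergence \<Omega> \<rho> x)
           + C\<^sub>F^2 / (lam * \<nu>\<^sub>m) * L2norm \<Omega> (\<lambda>x. \<rho> x - \<nu> x *\<^sub>R weak_gradient \<Omega> \<zeta> x)
           + C\<^sub>F * L2norm \<Omega> (\<lambda>x. f x + v\<^sub>\<zeta> x + weak_divergence \<Omega> \<tau> x)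
           + L2norm \<Omega> (\<lambda>x. \<tau> x - \<nu> x *\<^sub>R weak_gradient \<Omega> \<eta> x))"
proof -
  have "open \<Omega>" "bounded \<Omega>"
    using domain by (auto simp: bounded_lipschitz_domain_def)
  then interpret control_problem \<Omega> \<nu> \<nu>\<^sub>m \<nu>\<^sub>M C\<^sub>F lam f y\<^sub>d u\<^sub>d u\<^sub>a u\<^sub>b S
    using data lam nu_measurable nu_bounds C_F state control_bounds by unfold_locales auto
  have v: "v\<^sub>\<zeta> \<in> U"
    by (rule clip_admissible[OF H10_L2[OF zeta] v_zeta])
  have "u \<in> U"
    using u by (simp add: optimal_control_def is_arg_min_def)
  then have est: "error_sq \<Omega> lam S u v\<^sub>\<zeta> \<le> error_majorant \<Omega> \<nu> \<nu>\<^sub>m C\<^sub>F lam f y\<^sub>d u\<^sub>d \<alpha> \<beta> \<eta> \<zeta> \<tau> \<rho> v\<^sub>\<zeta>"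
    unfolding error_majorant_def
    using error_sq_le_cost_diff[OF u v] cost_le_majorant[OF admissible_L2[OF v] eta tau alpha beta]
      minorant_le_cost[OF _ v zeta v_zeta eta tau rho]
    by fastforce
  \<comment> \<open>The control cost l cancels, and the two misfit terms combine with coefficient (1
    + \<alpha>) / 2 - 1 / 2 = \<alpha> / 2.\<close>
  have rearrange: "(p + q + r + l) - (h + l + i + j - w) = a + q + r - i - j + w"
    if "p - h = a" for p q r l h i j w a :: real
    using that by simp
  show ?thesis
    by (intro conjI v est)
      (unfold error_majorant_def cost_majorant_def cost_minorant_def, rule rearrange, simp add: field_simps)
qed

end
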